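(* The forward operator $F:D(F)\subset H^2(\underline u,\overline u)\to L^2(0,T)$, $a\mapsto\triangle p$ (defined in the context), is Lipschitz continuous, i.e. $$\|F(a)-F(\tilde a)\|_{L^2(0,T)}\le C_L\,\|a-\tilde a\|_{H^2(\underline u,\overline u)}\qquad\text{for all } a,\tilde a\in D(F),$$ with some uniform Lipschitz constant $C_L$ independent of the choice of $a$ and $\tilde a$.
   Context: Fix $T>0$ and positive constants $a_0,a_1,a_2,a_3$. Consider the condition (A1) $a\in W^{3,\infty}_{loc}(\mathbb R)$ with $a(0)=0$, $a_0\le a'(\cdot)\le a_1$, $|a''(\cdot)|\le a_2$, $|a'''(\cdot)|\le a_3$. Fix data satisfying (A2) $u_0=0$ and $p_0=c$ with $c\in\mathbb R$; (A3) $g_0,g_1\in C^4([0,T])$, $g_0(0)=g_1(0)=0$, $g_0'(0)=g_1'(0)=0$. State system: for $a$ satisfying (A1), $(p,u)\in C^1([0,T];L^2(0,1)^2)\cap C([0,T];H^1(0,1)^2)$ denotes the unique classical solution of $\partial_t p+\partial_x u=0$, $\partial_t u+\partial_x p+a(u)=0$ on $(0,1)\times(0,T)$ with $u(0,t)=g_0(t)$, $u(1,t)=g_1(t)$, $p(\cdot,0)=p_0$, $u(\cdot,0)=u_0$. There are constants $\underline u<\overline u$, independent of $a$, such that $\underline u\le u(x,t)\le\overline u$ for all $x\in[0,1]$, $t\in[0,T]$ and every $a$ satisfying (A1); fix such constants. Parameters are restricted to $[\underline u,\overline u]$ (the solution only depends on this restriction), and $D(F)=\{a\in H^2(\underline u,\overline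 u): \text{(A1) holds}\}$, i.e. the set of restrictions to $[\underline u,\overline u]$ of functions satisfying (A1) with the fixed constants. The forward operator is $F(a)=\triangle p:=p(0,\cdot)-p(1,\cdot)$, where $(p,u)$ is the solution for the parameter $a$. *)

theory Defs
  imports "HOL-Analysis.Analysis"
begin

definition L2 :: "real set \<Rightarrow> (real \<Rightarrow> real) set" where
  "L2 S = {f. f \<in> borel_measurable (lebesgue_on S) \<and> integrable (lebesgue_on S) (\<lambda>x. (f x)\<^sup>2)}"

definition L2_norm :: "real set \<Rightarrow> (real \<Rightarrow> real) \<Rightarrow> real" where
  "L2_norm S f = sqrt (LINT x|lebesgue_on S. (f x)\<^sup>2)"

definition test_function :: "real set \<Rightarrow> (real \<Rightarrow> real) \<Rightarrow> bool" where
  "test_function S \<phi> \<longleftrightarrow>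
     (\<forall>k x. (deriv ^^ k) \<phi> differentiable (at x)) \<and>
     (\<exists>K. compact K \<and> K \<subseteq> S \<and> (\<forall>x. x \<notin> K \<longrightarrow> \<phi> x = 0))"

definition locally_integrable :: "real set \<Rightarrow> (real \<Rightarrow> real) \<Rightarrow> bool" where
  "locally_integrable S f \<longleftrightarrow> (\<forall>K. compact K \<and> K \<subseteq> S \<longrightarrow> integrable (lebesgue_on K) f)"

definition has_weak_deriv :: "nat \<Rightarrow> real set \<Rightarrow> (real \<Rightarrow> real) \<Rightarrow> (real \<Rightarrow> real) \<Rightarrow> bool" where
  "has_weak_deriv k S f g \<longleftrightarrow>
     locally_integrable S f \<and> locally_integrable S g \<and>
     (\<forall>\<phi>. test_function S \<phi> \<longrightarrow>
        (LINT x|lebesgue_on S. f x * (deriv ^^ k) \<phi> x) = (-1) ^ k * (LINT x|lebesgue_on S. g x * \<phi> x))"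

text \<open>On an open set the weak derivative is unique only up to null sets; the choice made here
  is immaterial because it is used only in integrals and almost-everywhere statements.\<close>

definition weak_deriv :: "nat \<Rightarrow> real set \<Rightarrow> (real \<Rightarrow> real) \<Rightarrow> real \<Rightarrow> real" where
  "weak_deriv k S f = (SOME g. has_weak_deriv k S f g)"

definition Hk :: "nat \<Rightarrow> real set \<Rightarrow> (real \<Rightarrow> real) set" where
  "Hk k S = {f. f \<in> L2 S \<and>
     (\<forall>j\<in>{1..k}. (\<exists>g. has_weak_deriv j S f g) \<and> weak_deriv j S f \<in> L2 S)}"

definition Hk_norm :: "nat \<Rightarrow> real set \<Rightarrow> (real \<Rightarrow> real) \<Rightarrow> real" where
  "Hk_norm k S f = sqrt ((L2_norm S f)\<^sup>2 + (\<Sum>j=1..k. (L2_norm S (weak_deriv j S f))\<^sup>2))"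

definition Linf_loc :: "real set \<Rightarrow> (real \<Rightarrow> real) set" where
  "Linf_loc S = {f. f \<in> borel_measurable (lebesgue_on S) \<and>
     (\<forall>K. compact K \<and> K \<subseteq> S \<longrightarrow> (\<exists>B. AE x in lebesgue_on K. \<bar>f x\<bar> \<le> B))}"

definition Wk_inf_loc :: "nat \<Rightarrow> real set \<Rightarrow> (real \<Rightarrow> real) set" where
  "Wk_inf_loc k S = {f. f \<in> Linf_loc S \<and>
     (\<forall>j\<in>{1..k}. (\<exists>g. has_weak_deriv j S f g) \<and> weak_deriv j S f \<in> Linf_loc S)}"

text \<open>Differentiability is relative to \<open>S\<close>, hence one-sided at the end points of an interval.\<close>

definition Ck_on :: "nat \<Rightarrow> real set \<Rightarrow> (real \<Rightarrow> real) \<Rightarrow> bool" where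
  "Ck_on k S g \<longleftrightarrow> (\<exists>d :: nat \<Rightarrow> real \<Rightarrow> real.
     d 0 = g \<and>
     (\<forall>i<k. \<forall>t\<in>S. (d i has_real_derivative d (Suc i) t) (at t within S)) \<and>
     continuous_on S (d k))"

text \<open>A function of time with values in a space of functions of \<open>x\<close> is a map \<open>v\<close> with
  \<open>v t x\<close> standing for $v(x,t)$; the space is given by its carrier \<open>X\<close> and its norm \<open>N\<close>
  (only a seminorm on representatives).\<close>

definition C0_valued ::
  "(real \<Rightarrow> real) set \<Rightarrow> ((real \<Rightarrow> real) \<Rightarrow> real) \<Rightarrow> real set \<Rightarrow> (real \<Rightarrow> real \<Rightarrow> real) \<Rightarrow> bool" where
  "C0_valued X N J v \<longleftrightarrow>
     (\<forall>t\<in>J. v t \<in> X) \<and>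
     (\<forall>t\<in>J. ((\<lambda>s. N (\<lambda>x. v s x - v t x)) \<longlongrightarrow> 0) (at t within J))"

definition C1_valued ::
  "(real \<Rightarrow> real) set \<Rightarrow> ((real \<Rightarrow> real) \<Rightarrow> real) \<Rightarrow> real set \<Rightarrow>
   (real \<Rightarrow> real \<Rightarrow> real) \<Rightarrow> (real \<Rightarrow> real \<Rightarrow> real) \<Rightarrow> bool" where
  "C1_valued X N J v v' \<longleftrightarrow>
     (\<forall>t\<in>J. v t \<in> X) \<and> C0_valued X N J v' \<and>
     (\<forall>t\<in>J. ((\<lambda>s. N (\<lambda>x. (v s x - v t x) / (s - t) - v' t x)) \<longlongrightarrow> 0) (at t within J))"

text \<open>Continuity selects the continuous representative, so that \<open>a 0\<close> and \<open>a (u t x)\<close> make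
  sense pointwise. The first two derivatives have continuous representatives as well, for which
  the almost-everywhere bounds are bounds everywhere.\<close>

definition admissible :: "real \<Rightarrow> real \<Rightarrow> real \<Rightarrow> real \<Rightarrow> (real \<Rightarrow> real) \<Rightarrow> bool" where
  "admissible a0 a1 a2 a3 a \<longleftrightarrow>
     continuous_on UNIV a \<and> a \<in> Wk_inf_loc 3 UNIV \<and> a 0 = 0 \<and>
     (AE s in lebesgue. a0 \<le> weak_deriv 1 UNIV a s \<and> weak_deriv 1 UNIV a s \<le> a1) \<and>
     (AE s in lebesgue. \<bar>weak_deriv 2 UNIV a s\<bar> \<le> a2) \<and>
     (AE s in lebesgue. \<bar>weak_deriv 3 UNIV a s\<bar> \<le> a3)"

text \<open>Classical solutions: $(p,u) \in C^1([0,T];L^2(0,1)^2) \cap C([0,T];H^1(0,1)^2)$. For each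
  \<open>t\<close> the representatives of \<open>p t\<close> and \<open>u t\<close> are the ones continuous on $[0,1]$, which gives
  the boundary values their meaning as traces.\<close>

definition classical_solution ::
  "real \<Rightarrow> real \<Rightarrow> (real \<Rightarrow> real) \<Rightarrow> (real \<Rightarrow> real) \<Rightarrow> (real \<Rightarrow> real) \<Rightarrow>
   (real \<Rightarrow> real \<Rightarrow> real) \<Rightarrow> (real \<Rightarrow> real \<Rightarrow> real) \<Rightarrow> bool" where
  "classical_solution T c g0 g1 a p u \<longleftrightarrow>
     (\<forall>t\<in>{0..T}. continuous_on {0..1} (p t) \<and> continuous_on {0..1} (u t)) \<and>
     C0_valued (Hk 1 {0<..<1}) (Hk_norm 1 {0<..<1}) {0..T} p \<and>
     C0_valued (Hk 1 {0<..<1}) (Hk_norm 1 {0<..<1}) {0..T} u \<and>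
     (\<exists>p' u'.
        C1_valued (L2 {0<..<1}) (L2_norm {0<..<1}) {0..T} p p' \<and>
        C1_valued (L2 {0<..<1}) (L2_norm {0<..<1}) {0..T} u u' \<and>
        (\<forall>t\<in>{0<..<T}. AE x in lebesgue_on {0<..<1}.
           p' t x + weak_deriv 1 {0<..<1} (u t) x = 0 \<and>
           u' t x + weak_deriv 1 {0<..<1} (p t) x + a (u t x) = 0)) \<and>
     (\<forall>t\<in>{0..T}. u t 0 = g0 t \<and> u t 1 = g1 t) \<and>
     (\<forall>x\<in>{0..1}. p 0 x = c \<and> u 0 x = 0)"

definition DF :: "real \<Rightarrow> real \<Rightarrow> real \<Rightarrow> real \<Rightarrow> real \<Rightarrow> real \<Rightarrow> (real \<Rightarrow> real) set" where
  "DF a0 a1 a2 a3 ul uh =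
     {a \<in> Hk 2 {ul<..<uh}. \<exists>b. admissible a0 a1 a2 a3 b \<and> (\<forall>s\<in>{ul..uh}. a s = b s)}"

text \<open>The graph of the forward operator \<open>F\<close>: on $[0,T]$, \<open>y\<close> is \<open>F a\<close>, the pressure drop
  $p(0,\cdot) - p(1,\cdot)$ of a solution whose parameter is an extension \<open>b\<close> of
  \<open>a\<close> (given on $[ul,uh]$) to the real line that is \<open>admissible\<close>. No choice of the extension or
  of the solution is made.\<close>

definition forward_graph ::
  "real \<Rightarrow> real \<Rightarrow> real \<Rightarrow> real \<Rightarrow> real \<Rightarrow> real \<Rightarrow> real \<Rightarrow> real \<Rightarrow> (real \<Rightarrow> real) \<Rightarrow> (real \<Rightarrow> real) \<Rightarrow>
   (real \<Rightarrow> real) \<Rightarrow> (real \<Rightarrow> real) \<Rightarrow> bool" where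
  "forward_graph a0 a1 a2 a3 ul uh T c g0 g1 a y \<longleftrightarrow>
     (\<exists>b p u. admissible a0 a1 a2 a3 b \<and> (\<forall>s\<in>{ul..uh}. a s = b s) \<and>
        classical_solution T c g0 g1 b p u \<and> y = (\<lambda>t. p t 0 - p t 1))"

end

theory Submission
  imports Defs
begin

text \<open>
  Let \<open>(p, u)\<close> and \<open>(q, v)\<close> be solutions for the parameters \<open>\<alpha>\<close> and \<open>\<beta>\<close>. The differences \<open>r = p - q\<close>
  and \<open>w = u - v\<close> solve a linear wave system with a source,
  $r_t + w_x = 0$ and $w_t + r_x + f = 0$, where $f = \alpha(u) - \beta(v)$, with zero initial values and
  with $w = 0$ at both ends. Writing $f = (\alpha(u) - \alpha(v)) + (\alpha - \beta)(v)$ gives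
  $|f| \le a_1 |w| + \delta$, where $\delta$ is the maximum of $|\alpha - \beta|$ over
  $[\underline u, \overline u]$, which contains all values of \<open>v\<close>. In one dimension \<open>\<delta>\<close> is at most
  a constant times the $H^1$ norm of \<open>\<alpha> - \<beta>\<close>, hence times its $H^2$ norm.

  The energy $e = \int_0^1 r^2 + w^2$ satisfies $e' = -2\int_0^1 w f$, because the boundary terms
  vanish with \<open>w\<close>; Gronwall's argument gives $e \le C \delta^2$. This alone does not control boundary
  values of \<open>r\<close>. They are reached without differentiating the system in time, through the Rellich
  multiplier $m(x) = 2x - 1$: the functional $M = \int_0^1 m r w$ satisfies
  \[ r(0,t)^2 + r(1,t)^2 = 2 e - 2 M' - 2 \int_0^1 m r f , \]
  and $2|M| \le e$, so integrating over \<open>[0, T]\<close> bounds both traces in $L^2(0,T)$ by a constant times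
  \<open>\<delta>\<close> (\<open>energy_and_multiplier_estimate\<close>).

  The solutions are differentiable merely in a weak sense in \<open>x\<close> and as $L^2$-valued functions in
  \<open>t\<close>, so the calculus behind these two identities is built first. A continuous function with a
  weak derivative is the indefinite integral of that derivative (\<open>weak_deriv_integral\<close>), which in turn
  makes weak derivatives unique almost everywhere (\<open>has_weak_deriv_unique\<close>) and gives the sup-norm
  bound by the $H^1$ norm (\<open>Hk_diff_sup_le\<close>); indefinite integrals obey the product rule
  (\<open>integration_by_parts_primitive\<close>), and integrals of products of $C^1$ curves in $L^2$
  are differentiable in time (\<open>weighted_L2_product_has_derivative\<close>).
\<close>

section \<open>Smooth transition functions\<close>

text \<open>For \<open>P = 1\<close> this is the standard smooth function that is flat at \<open>0\<close>. The polynomial factor in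
  \<open>1 / x\<close> makes the family closed under differentiation.\<close>
definition flat_exp :: "real poly \<Rightarrow> real \<Rightarrow> real" where
  "flat_exp P x = (if x > 0 then poly P (1 / x) * exp (- 1 / x) else 0)"

lemma poly_mult_exp_minus_tendsto_0:
  fixes P :: "real poly"
  shows "((\<lambda>y. poly P y * exp (- y)) \<longlongrightarrow> 0) at_top"
proof -
  have "((\<lambda>y. \<Sum>i\<le>degree P. coeff P i * (y ^ i / exp y)) \<longlongrightarrow> (\<Sum>i\<le>degree P. coeff P i * 0)) at_top"
    by (intro tendsto_intros tendsto_power_div_exp_0)
  then show ?thesis
    by (simp add: poly_altdef sum_distrib_right exp_minus divide_inverse mult.assoc)
qed

text \<open>Away from \<open>0\<close> this is the chain rule. At \<open>0\<close> the difference quotient from the right is again of the form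
  \<open>poly Q y * exp (- y)\<close> with \<open>y = 1 / x\<close> tending to infinity.\<close>
lemma flat_exp_has_derivative:
  "(flat_exp P has_real_derivative flat_exp (pCons 0 (pCons 0 (P - pderiv P))) x) (at x)"
proof -
  consider "x > 0" | "x < 0" | "x = 0" by linarith
  then show ?thesis
  proof cases
    case 1
    have "((\<lambda>x. poly P (1 / x) * exp (- 1 / x)) has_real_derivative
        flat_exp (pCons 0 (pCons 0 (P - pderiv P))) x) (at x)"
    proof -
      have i: "((\<lambda>x. 1 / x) has_real_derivative - (1 / x\<^sup>2)) (at x)"
        using 1 by (auto intro!: derivative_eq_intros simp: power2_eq_square)
      have e: "((\<lambda>x. exp (- 1 / x)) has_real_derivative exp (- 1 / x) * (1 / x\<^sup>2)) (at x)"
        using 1 by (auto intro!: derivative_eq_intros simp: power2_eq_square)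
      show ?thesis
        using DERIV_mult[OF DERIV_chain2[OF poly_DERIV i, of P] e] 1
        by (simp add: flat_exp_def algebra_simps power2_eq_square)
    qed
    then show ?thesis
      by (rule has_field_derivative_transform_within_open[where S="{0<..}"])
         (use 1 in \<open>auto simp: flat_exp_def\<close>)
  next
    case 2
    have "((\<lambda>x. 0) has_real_derivative flat_exp (pCons 0 (pCons 0 (P - pderiv P))) x) (at x)"
      using 2 by (auto simp: flat_exp_def)
    then show ?thesis
      by (rule has_field_derivative_transform_within_open[where S="{..<0}"])
         (use 2 in \<open>auto simp: flat_exp_def\<close>)
  next
    case 3
    have r: "((\<lambda>h. (flat_exp P (0 + h) - flat_exp P 0) / h) \<longlongrightarrow> 0) (at_right 0)"
    proof -
      have "((\<lambda>h. poly (pCons 0 P) (inverse h) * exp (- inverse h)) \<longlongrightarrow> 0) (at_right 0)"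
        by (rule filterlim_compose[OF poly_mult_exp_minus_tendsto_0 filterlim_inverse_at_top_right])
      then show ?thesis
        by (rule Lim_transform_eventually)
           (auto simp: eventually_at_filter flat_exp_def divide_inverse mult_ac)
    qed
    have l: "((\<lambda>h. (flat_exp P (0 + h) - flat_exp P 0) / h) \<longlongrightarrow> 0) (at_left 0)"
      by (rule Lim_transform_eventually[OF tendsto_const])
         (auto simp: eventually_at_filter flat_exp_def)
    show ?thesis
      unfolding 3 DERIV_def using filterlim_split_at[OF l r] by (simp add: flat_exp_def)
  qed
qed

text \<open>The clauses provide exactly what the construction of test functions uses, and each of them
  preserves closure under differentiation. So every member is infinitely differentiable, and no formula
  for a higher derivative is ever needed.\<close>
inductive_set smooth_functions :: "(real \<Rightarrow> real) set" where
  flat: "flat_exp P \<in> smooth_functions"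
| add: "f \<in> smooth_functions \<Longrightarrow> g \<in> smooth_functions \<Longrightarrow> (\<lambda>x. f x + g x) \<in> smooth_functions"
| mult: "f \<in> smooth_functions \<Longrightarrow> g \<in> smooth_functions \<Longrightarrow> (\<lambda>x. f x * g x) \<in> smooth_functions"
| affine: "f \<in> smooth_functions \<Longrightarrow> (\<lambda>x. c * f (m * x + b)) \<in> smooth_functions"
| antiderivative: "(\<And>x. (F has_real_derivative f x) (at x)) \<Longrightarrow> f \<in> smooth_functions \<Longrightarrow>
    F \<in> smooth_functions"

lemma smooth_functions_derivative:
  assumes "f \<in> smooth_functions"
  shows "\<exists>f'\<in>smooth_functions. \<forall>x. (f has_real_derivative f' x) (at x)"
  using assms
proof induction
  case (flat P)
  show ?case by (rule bexI[OF _ smooth_functions.flat]) (use flat_exp_has_derivative in blast)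
next
  case (add f g)
  then obtain f' g' where *: "f' \<in> smooth_functions" "g' \<in> smooth_functions"
    and [derivative_intros]: "\<And>x. (f has_real_derivative f' x) (at x)" "\<And>x. (g has_real_derivative g' x) (at x)"
    by blast
  show ?case
    by (rule bexI[OF _ smooth_functions.add[OF *]]) (auto intro!: derivative_eq_intros)
next
  case (mult f g)
  then obtain f' g' where *: "f' \<in> smooth_functions" "g' \<in> smooth_functions"
    and [derivative_intros]: "\<And>x. (f has_real_derivative f' x) (at x)" "\<And>x. (g has_real_derivative g' x) (at x)"
    by blast
  show ?case
    by (rule bexI[OF _ smooth_functions.add[OF smooth_functions.mult[OF *(1) mult.hyps(2)]
          smooth_functions.mult[OF *(2) mult.hyps(1)]]])
       (auto intro!: derivative_eq_intros)
next
  case (affine f c m b)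
  then obtain f' where *: "f' \<in> smooth_functions"
    and d: "\<And>x. (f has_real_derivative f' x) (at x)"
    by blast
  have "((\<lambda>x. f (m * x + b)) has_real_derivative f' (m * x + b) * m) (at x)" for x
    by (rule DERIV_chain2[OF d]) (auto intro!: derivative_eq_intros)
  from DERIV_cmult[OF this, of c]
  have "\<forall>x. ((\<lambda>x. c * f (m * x + b)) has_real_derivative (c * m) * f' (m * x + b)) (at x)"
    by (simp add: mult_ac)
  then show ?case by (rule bexI[OF _ smooth_functions.affine[OF *]])
next
  case (antiderivative F f)
  show ?case using antiderivative.hyps by (intro bexI[of _ f]) auto
qed

lemma smooth_functions_deriv:
  assumes "f \<in> smooth_functions"
  shows "(deriv ^^ k) f \<in> smooth_functions"
proof (induction k)
  case (Suc k)
  then obtain f' where f': "f' \<in> smooth_functions" "\<forall>x. ((deriv ^^ k) f has_real_derivative f' x) (at x)"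
    using smooth_functions_derivative[OF Suc] by auto
  then have "deriv ((deriv ^^ k) f) = f'" by (auto intro: DERIV_imp_deriv)
  then show ?case using f' by simp
qed (use assms in simp)

lemma smooth_functions_differentiable:
  assumes "f \<in> smooth_functions"
  shows "(deriv ^^ k) f differentiable (at x)"
  using smooth_functions_derivative[OF smooth_functions_deriv[OF assms, of k]]
  by (auto simp: real_differentiable_def)

text \<open>The step is the normalised antiderivative of the bump \<open>exp (- 1 / x) * exp (- 1 / (1 - x))\<close>
  supported in \<open>[0, 1]\<close>. Rescaled steps are cut-off functions whose derivatives concentrate at a point.\<close>
lemma smooth_step:
  obtains S s :: "real \<Rightarrow> real" where
    "S \<in> smooth_functions" "\<And>x. (S has_real_derivative s x) (at x)" "continuous_on UNIV s"
    "\<And>x. s x \<ge> 0" "\<And>x. x \<notin> {0..1} \<Longrightarrow> s x = 0"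
    "\<And>x. x \<le> 0 \<Longrightarrow> S x = 0" "\<And>x. x \<ge> 1 \<Longrightarrow> S x = 1"
proof -
  define \<psi> where "\<psi> = (\<lambda>x. flat_exp 1 x * (1 * flat_exp 1 ((- 1) * x + 1)))"
  have sm: "\<psi> \<in> smooth_functions"
    unfolding \<psi>_def
    by (rule smooth_functions.mult[OF smooth_functions.flat smooth_functions.affine[OF smooth_functions.flat]])
  have nn: "\<psi> x \<ge> 0" for x by (simp add: \<psi>_def flat_exp_def)
  have zero: "\<psi> x = 0" if "x \<notin> {0<..<1}" for x using that by (auto simp: \<psi>_def flat_exp_def)
  have pos: "\<psi> x > 0" if "0 < x" "x < 1" for x using that by (simp add: \<psi>_def flat_exp_def)
  obtain \<psi>' where "\<And>x. (\<psi> has_real_derivative \<psi>' x) (at x)"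
    using smooth_functions_derivative[OF sm] by auto
  then have cont: "continuous_on UNIV \<psi>"
    by (meson DERIV_isCont continuous_at_imp_continuous_on)
  define \<Phi> where "\<Phi> x = integral {0..x} \<psi>" for x
  have \<Phi>': "(\<Phi> has_real_derivative \<psi> x) (at x)" for x
  proof -
    define a where "a = min 0 x - 1"
    \<comment> \<open>The lower limit \<open>0\<close> may be moved to \<open>a\<close> because \<open>\<psi>\<close> vanishes to the left of \<open>0\<close>; then \<open>x\<close> is an
      interior point of the interval and the fundamental theorem gives a two-sided derivative.\<close>
    have eq: "integral {a..z} \<psi> = \<Phi> z" if "z > a" for z
    proof (cases "z \<le> 0")
      case True
      have "integral {a..z} \<psi> = integral {a..z} (\<lambda>x. 0)"
        by (rule integral_cong) (use True in \<open>auto intro: zero\<close>)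
      moreover have "integral {0..z} \<psi> = 0" using True by (cases "z = 0") auto
      ultimately show ?thesis by (simp add: \<Phi>_def)
    next
      case False
      have "integral {a..0} \<psi> = integral {a..0} (\<lambda>x. 0)"
        by (rule integral_cong) (auto intro: zero)
      moreover have "integral {a..0} \<psi> + integral {0..z} \<psi> = integral {a..z} \<psi>"
        using False that
        by (intro Henstock_Kurzweil_Integration.integral_combine integrable_continuous_real
            continuous_on_subset[OF cont]) (auto simp: a_def)
      ultimately show ?thesis by (simp add: \<Phi>_def)
    qed
    have "((\<lambda>z. integral {a..z} \<psi>) has_real_derivative \<psi> x) (at x within {a..x+1})"
      by (rule integral_has_real_derivative) (auto simp: a_def intro: continuous_on_subset[OF cont])
    moreover have "at x within {a..x+1} = at x"
      by (rule at_within_interior) (auto simp: a_def)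
    ultimately have "((\<lambda>z. integral {a..z} \<psi>) has_real_derivative \<psi> x) (at x)" by simp
    then show ?thesis
      by (rule has_field_derivative_transform_within_open[where S="{a<..}"])
         (auto simp: a_def[symmetric] eq, simp add: a_def)
  qed
  have \<Phi>0: "\<Phi> x = 0" if "x \<le> 0" for x using that unfolding \<Phi>_def by (cases "x = 0") auto
  have \<Phi>1: "\<Phi> x = \<Phi> 1" if "x \<ge> 1" for x
  proof (cases "x = 1")
    case False
    have "(\<Phi> has_real_derivative 0) (at y)" if "1 < y" for y
      using \<Phi>'[of y] zero[of y] that by simp
    then show ?thesis
      by (intro DERIV_isconst2[of 1 x \<Phi>] continuous_at_imp_continuous_on ballI DERIV_isCont[OF \<Phi>'])
         (use False that in auto)
  qed simp
  have "\<Phi> 0 < \<Phi> 1"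
    using \<Phi>' pos
    by (intro DERIV_pos_imp_increasing_open[of 0 1 \<Phi>] continuous_at_imp_continuous_on ballI
        DERIV_isCont[OF \<Phi>']) auto
  then have c: "\<Phi> 1 > 0" using \<Phi>0 by simp
  define S where "S = (\<lambda>x. (1 / \<Phi> 1) * \<Phi> (1 * x + 0))"
  define s where "s = (\<lambda>x. \<psi> x / \<Phi> 1)"
  show thesis
  proof
    show "S \<in> smooth_functions"
      unfolding S_def by (rule smooth_functions.affine[OF smooth_functions.antiderivative[OF \<Phi>' sm]])
    show "(S has_real_derivative s x) (at x)" for x
      unfolding S_def s_def using c by (auto intro!: derivative_eq_intros \<Phi>')
    show "continuous_on UNIV s" unfolding s_def using c by (intro continuous_intros cont) auto
    show "s x \<ge> 0" for x using c nn by (simp add: s_def)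
    show "s x = 0" if "x \<notin> {0..1}" for x using zero[of x] that by (auto simp: s_def)
    show "S x = 0" if "x \<le> 0" for x using \<Phi>0 that by (simp add: S_def)
    show "S x = 1" if "x \<ge> 1" for x using \<Phi>1[OF that] c by (simp add: S_def)
  qed
qed

section \<open>Weak derivatives of functions of one variable\<close>

lemma integral_lebesgue_on_support:
  fixes f :: "real \<Rightarrow> real"
  assumes "S \<in> sets lebesgue" "K \<in> sets lebesgue" "K \<subseteq> S" "\<And>x. x \<notin> K \<Longrightarrow> f x = 0"
  shows "(LINT x|lebesgue_on S. f x) = (LINT x|lebesgue_on K. f x)"
proof -
  have "indicator S x *\<^sub>R f x = indicator K x *\<^sub>R f x" for x
    using assms(3,4) by (cases "x \<in> K") (auto simp: indicator_def)
  then have "(LINT x|lebesgue. indicator S x *\<^sub>R f x) = (LINT x|lebesgue. indicator K x *\<^sub>R f x)"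
    by (intro Bochner_Integration.integral_cong) auto
  then show ?thesis using assms(1,2) by (simp add: integral_restrict_space)
qed

lemma integral_concentrating_kernel_tendsto:
  fixes f :: "real \<Rightarrow> real" and k :: "nat \<Rightarrow> real \<Rightarrow> real"
  assumes f: "continuous_on {x..y} f" and z: "z \<in> {x..y}"
    and k: "\<forall>\<^sub>F n in sequentially. continuous_on {x..y} (k n) \<and> integral {x..y} (k n) = 1 \<and>
      (\<forall>t\<in>{x..y}. 0 \<le> k n t \<and> (1 / real n < \<bar>t - z\<bar> \<longrightarrow> k n t = 0))"
  shows "(\<lambda>n. integral {x..y} (\<lambda>t. f t * k n t)) \<longlonglongrightarrow> f z"
proof (rule tendstoI)
  fix e :: real assume "e > 0"
  then have e2: "e / 2 > 0" by simp
  from f z e2 obtain d where d: "d > 0" "\<And>t. t \<in> {x..y} \<Longrightarrow> dist t z < d \<Longrightarrow> dist (f t) (f z) < e / 2"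
    unfolding continuous_on_iff by meson
  have "\<forall>\<^sub>F n in sequentially. 1 / real n < d"
    using order_tendstoD(2)[OF lim_1_over_n d(1)] .
  with k show "\<forall>\<^sub>F n in sequentially. dist (integral {x..y} (\<lambda>t. f t * k n t)) (f z) < e"
  proof eventually_elim
    case (elim n)
    then have c: "continuous_on {x..y} (k n)" and i: "integral {x..y} (k n) = 1" by auto
    have bd: "norm ((f t - f z) * k n t) \<le> (e / 2) * k n t" if "t \<in> {x..y}" for t
    proof (cases "\<bar>t - z\<bar> < d")
      case True
      then have "\<bar>f t - f z\<bar> \<le> e / 2" using d(2)[OF that] by (simp add: dist_real_def)
      moreover have "0 \<le> k n t" using elim that by auto
      ultimately show ?thesis using mult_right_mono[of _ "e / 2" "k n t"] by (simp add: abs_mult)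
    next
      case False
      then show ?thesis using elim that by auto
    qed
    have "integral {x..y} (\<lambda>t. (f t - f z) * k n t) =
        integral {x..y} (\<lambda>t. f t * k n t) - integral {x..y} (\<lambda>t. f z * k n t)"
      unfolding left_diff_distrib
      by (intro Henstock_Kurzweil_Integration.integral_diff integrable_continuous_real continuous_intros f c)
    also have "integral {x..y} (\<lambda>t. f z * k n t) = f z" using i by simp
    finally have eq: "integral {x..y} (\<lambda>t. f t * k n t) - f z = integral {x..y} (\<lambda>t. (f t - f z) * k n t)" by simp
    have "norm (integral {x..y} (\<lambda>t. (f t - f z) * k n t)) \<le> integral {x..y} (\<lambda>t. (e / 2) * k n t)"
      by (intro integral_norm_bound_integral integrable_continuous_real continuous_intros f c bd)
    also have "\<dots> = e / 2" using i by simp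
    finally show ?case using \<open>e > 0\<close> by (simp add: dist_norm eq)
  qed
qed

text \<open>Test the weak derivative with functions \<open>\<phi> n\<close> that rise from \<open>0\<close> to \<open>1\<close> on \<open>[x, x + 1 / n]\<close> and fall back
  on \<open>[y - 1 / n, y]\<close>. The derivative of \<open>\<phi> n\<close> is the difference of two kernels of mass one concentrating at
  \<open>x\<close> and at \<open>y\<close>, while \<open>\<phi> n\<close> itself tends to the indicator of the interval.\<close>
lemma weak_deriv_integral:
  assumes S: "open S" and wd: "has_weak_deriv 1 S f g" and f: "continuous_on S f"
    and sub: "{x..y} \<subseteq> S" and "x \<le> y"
  shows "integrable (lebesgue_on {x..y}) g" and "f y - f x = (LINT t|lebesgue_on {x..y}. g t)"
proof -
  show g: "integrable (lebesgue_on {x..y}) g"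
    using wd sub by (auto simp: has_weak_deriv_def locally_integrable_def)
  show "f y - f x = (LINT t|lebesgue_on {x..y}. g t)"
  proof (cases "x = y")
    case True
    then show ?thesis using lebesgue_integral_eq_integral[OF g] by simp
  next
    case False
    then have xy: "x < y" using \<open>x \<le> y\<close> by simp
    have fc: "continuous_on {x..y} f" by (rule continuous_on_subset[OF f sub])
    obtain H h :: "real \<Rightarrow> real" where sm: "H \<in> smooth_functions"
      and H': "\<And>x. (H has_real_derivative h x) (at x)" and hc: "continuous_on UNIV h"
      and h0: "\<And>x. h x \<ge> 0" "\<And>x. x \<notin> {0..1} \<Longrightarrow> h x = 0"
      and H0: "\<And>x. x \<le> 0 \<Longrightarrow> H x = 0" and H1: "\<And>x. x \<ge> 1 \<Longrightarrow> H x = 1"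
      by (rule smooth_step) blast
    have Hmono: "H s \<le> H t" if "s \<le> t" for s t
      by (rule DERIV_nonneg_imp_nondecreasing[OF that]) (use H' h0 in auto)
    have Hb: "0 \<le> H t" "H t \<le> 1" for t
      using Hmono[of "min t 0" t] H0[of "min t 0"] Hmono[of t "max t 1"] H1[of "max t 1"] by auto
    define k1 where "k1 n t = real n * h (real n * (t - x))" for n t
    define k2 where "k2 n t = real n * h (real n * (t - y) + 1)" for n t
    define \<phi> where "\<phi> n t = H (real n * (t - x)) - H (real n * (t - y) + 1)" for n t
    have d1: "((\<lambda>t. H (real n * (t - x))) has_real_derivative k1 n t) (at t within A)" for n t A
    proof -
      have "((\<lambda>t. real n * (t - x)) has_real_derivative real n) (at t)"
        by (auto intro!: derivative_eq_intros)
      from DERIV_chain2[OF H' this] show ?thesis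
        by (simp add: k1_def mult_ac has_field_derivative_at_within)
    qed
    have d2: "((\<lambda>t. H (real n * (t - y) + 1)) has_real_derivative k2 n t) (at t within A)" for n t A
    proof -
      have "((\<lambda>t. real n * (t - y) + 1) has_real_derivative real n) (at t)"
        by (auto intro!: derivative_eq_intros)
      from DERIV_chain2[OF H' this] show ?thesis
        by (simp add: k2_def mult_ac has_field_derivative_at_within)
    qed
    have kc: "continuous_on A (k1 n)" "continuous_on A (k2 n)" for A n
      unfolding k1_def k2_def
      by (intro continuous_intros continuous_on_compose2[OF hc]; simp)+
    have k_nn: "0 \<le> k1 n t" "0 \<le> k2 n t" for n t by (auto simp: k1_def k2_def h0)
    have \<phi>': "deriv (\<phi> n) = (\<lambda>t. k1 n t - k2 n t)" for n
      unfolding \<phi>_def by (intro ext DERIV_imp_deriv DERIV_diff d1 d2)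
    have \<phi>sm: "\<phi> n \<in> smooth_functions" for n
    proof -
      have "(\<lambda>t. 1 * H (real n * t + (- real n * x)) + (- 1) * H (real n * t + (1 - real n * y))) \<in> smooth_functions"
        by (intro smooth_functions.add smooth_functions.affine sm)
      also have "(\<lambda>t. 1 * H (real n * t + (- real n * x)) + (- 1) * H (real n * t + (1 - real n * y))) = \<phi> n"
        by (auto simp: \<phi>_def fun_eq_iff algebra_simps)
      finally show ?thesis .
    qed
    \<comment> \<open>For \<open>n * (y - x) \<ge> 1\<close> the rise is complete before the fall begins, and \<open>\<phi> n\<close> is supported in \<open>[x, y]\<close>.\<close>
    have large: "\<forall>\<^sub>F n in sequentially. 1 \<le> real n * c" if "c > 0" for c
      using that by real_asymp
    have ev: "\<forall>\<^sub>F n in sequentially. 1 \<le> real n * (y - x) \<and> 0 < n"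
      using eventually_conj[OF large[of "y - x"] eventually_gt_at_top[of 0]] xy by simp
    have out: "\<phi> n t = 0" if n: "1 \<le> real n * (y - x)" and t: "t \<notin> {x..y}" for n t
    proof -
      consider "t < x" | "t > y" using t by fastforce
      then show ?thesis
      proof cases
        case 1
        have "real n * (t - x) \<le> 0" using 1 by (simp add: mult_nonneg_nonpos)
        moreover have "real n * (t - y) + 1 \<le> 0" using n calculation by (simp add: algebra_simps)
        ultimately show ?thesis using H0 by (simp add: \<phi>_def)
      next
        case 2
        have "0 \<le> real n * (t - y)" using 2 by simp
        moreover have "1 \<le> real n * (t - x)" using n calculation by (simp add: algebra_simps)
        ultimately show ?thesis using H1 by (simp add: \<phi>_def)
      qed
    qed
    have S': "S \<in> sets lebesgue" using S by simp
    have test: "integral {x..y} (\<lambda>t. f t * k1 n t) - integral {x..y} (\<lambda>t. f t * k2 n t) =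
        - (LINT t|lebesgue_on {x..y}. g t * \<phi> n t)"
      if n: "1 \<le> real n * (y - x)" for n
    proof -
      have "test_function S (\<phi> n)"
        unfolding test_function_def using smooth_functions_differentiable[OF \<phi>sm] out[OF n] sub
        by (intro conjI allI exI[of _ "{x..y}"]) auto
      then have "(LINT t|lebesgue_on S. f t * (k1 n t - k2 n t)) = - (LINT t|lebesgue_on S. g t * \<phi> n t)"
        using wd by (auto simp: has_weak_deriv_def \<phi>')
      also have "(LINT t|lebesgue_on S. g t * \<phi> n t) = (LINT t|lebesgue_on {x..y}. g t * \<phi> n t)"
        by (rule integral_lebesgue_on_support) (use S' sub out[OF n] in auto)
      also have "(LINT t|lebesgue_on S. f t * (k1 n t - k2 n t)) = (LINT t|lebesgue_on {x..y}. f t * (k1 n t - k2 n t))"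
      proof (rule integral_lebesgue_on_support)
        fix t assume t: "t \<notin> {x..y}"
        have "(\<phi> n has_real_derivative 0) (at t)"
          by (rule has_field_derivative_transform_within_open[OF DERIV_const, of "- {x..y}"])
             (use t out[OF n] in \<open>auto simp: open_Compl\<close>)
        then have "deriv (\<phi> n) t = 0" by (rule DERIV_imp_deriv)
        then show "f t * (k1 n t - k2 n t) = 0" by (simp add: \<phi>')
      qed (use S' sub in auto)
      also have "\<dots> = integral {x..y} (\<lambda>t. f t * (k1 n t - k2 n t))"
        by (intro lebesgue_integral_eq_integral continuous_imp_integrable_real continuous_intros fc kc) simp
      also have "\<dots> = integral {x..y} (\<lambda>t. f t * k1 n t) - integral {x..y} (\<lambda>t. f t * k2 n t)"
        unfolding right_diff_distrib
        by (intro Henstock_Kurzweil_Integration.integral_diff integrable_continuous_real continuous_intros fc kc)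
      finally show ?thesis .
    qed
    have i1: "integral {x..y} (k1 n) = 1" if "1 \<le> real n * (y - x)" for n
    proof -
      have "(k1 n has_integral (H (real n * (y - x)) - H (real n * (x - x)))) {x..y}"
        by (rule fundamental_theorem_of_calculus)
           (use xy d1 in \<open>auto simp: has_real_derivative_iff_has_vector_derivative[symmetric]\<close>)
      then show ?thesis using that H0 H1 by (simp add: integral_unique)
    qed
    have i2: "integral {x..y} (k2 n) = 1" if "1 \<le> real n * (y - x)" for n
    proof -
      have "(k2 n has_integral (H (real n * (y - y) + 1) - H (real n * (x - y) + 1))) {x..y}"
        by (rule fundamental_theorem_of_calculus)
           (use xy d2 in \<open>auto simp: has_real_derivative_iff_has_vector_derivative[symmetric]\<close>)
      moreover have "real n * (x - y) + 1 \<le> 0" using that by (simp add: algebra_simps)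
      ultimately show ?thesis using H0 H1 by (simp add: integral_unique)
    qed
    have z1: "k1 n t = 0" if "1 / real n < \<bar>t - x\<bar>" "t \<in> {x..y}" "n > 0" for n t
    proof -
      have "1 < real n * (t - x)" using that by (simp add: field_simps)
      then show ?thesis by (simp add: k1_def h0)
    qed
    have z2: "k2 n t = 0" if "1 / real n < \<bar>t - y\<bar>" "t \<in> {x..y}" "n > 0" for n t
    proof -
      have "1 < real n * (y - t)" using that by (simp add: field_simps)
      then have "real n * (t - y) + 1 < 0" by (simp add: algebra_simps)
      then show ?thesis by (simp add: k2_def h0)
    qed
    have l1: "(\<lambda>n. integral {x..y} (\<lambda>t. f t * k1 n t)) \<longlonglongrightarrow> f x"
      by (rule integral_concentrating_kernel_tendsto[OF fc])
         (use xy in simp, rule eventually_mono[OF ev], use i1 z1 kc k_nn in auto)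
    have l2: "(\<lambda>n. integral {x..y} (\<lambda>t. f t * k2 n t)) \<longlonglongrightarrow> f y"
      by (rule integral_concentrating_kernel_tendsto[OF fc])
         (use xy in simp, rule eventually_mono[OF ev], use i2 z2 kc k_nn in auto)
    have l3: "(\<lambda>n. LINT t|lebesgue_on {x..y}. g t * \<phi> n t) \<longlonglongrightarrow> (LINT t|lebesgue_on {x..y}. g t)"
    proof (rule integral_dominated_convergence[where w = "\<lambda>t. \<bar>g t\<bar>"])
      have "continuous_on {x..y} (\<phi> n)" for n
        unfolding \<phi>_def using d1 d2
        by (intro continuous_intros) (auto intro!: DERIV_continuous_on)
      then have "\<phi> n \<in> borel_measurable (lebesgue_on {x..y})" for n
        by (intro continuous_imp_measurable_on_sets_lebesgue) auto
      then show "(\<lambda>t. g t * \<phi> n t) \<in> borel_measurable (lebesgue_on {x..y})" for n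
        using g by (intro borel_measurable_times) auto
      show "AE t in lebesgue_on {x..y}. norm (g t * \<phi> n t) \<le> \<bar>g t\<bar>" for n
      proof (rule AE_I2)
        fix t
        have "\<bar>\<phi> n t\<bar> \<le> 1" using Hb[of "real n * (t - x)"] Hb[of "real n * (t - y) + 1"] by (auto simp: \<phi>_def)
        then show "norm (g t * \<phi> n t) \<le> \<bar>g t\<bar>" by (simp add: abs_mult mult_left_le)
      qed
      have lim: "(\<lambda>n. g t * \<phi> n t) \<longlonglongrightarrow> g t" if "x < t" "t < y" for t
      proof -
        have "\<forall>\<^sub>F n in sequentially. g t * \<phi> n t = g t"
          using large[of "t - x", simplified, OF that(1)] large[of "y - t", simplified, OF that(2)]
        proof eventually_elim
          case (elim n)
          then have "real n * (t - y) + 1 \<le> 0" by (simp add: algebra_simps)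
          then show ?case using elim H0 H1 by (simp add: \<phi>_def)
        qed
        then show ?thesis by (rule tendsto_eventually)
      qed
      have "{x, y} \<in> null_sets lebesgue" by (simp add: negligible_iff_null_sets[symmetric])
      then have "AE t in lebesgue. t \<notin> {x, y}" by (rule AE_not_in)
      then have "AE t in lebesgue. t \<in> {x..y} \<longrightarrow> (\<lambda>n. g t * \<phi> n t) \<longlonglongrightarrow> g t"
        by (rule AE_mp) (auto intro!: AE_I2 lim)
      then show "AE t in lebesgue_on {x..y}. (\<lambda>n. g t * \<phi> n t) \<longlonglongrightarrow> g t"
        by (simp add: AE_restrict_space_iff)
    qed (use g in auto)
    have "(\<lambda>n. - (LINT t|lebesgue_on {x..y}. g t * \<phi> n t)) \<longlonglongrightarrow> f x - f y"
      by (rule Lim_transform_eventually[OF tendsto_diff[OF l1 l2]])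
         (rule eventually_mono[OF ev], use test in auto)
    from LIMSEQ_unique[OF this tendsto_minus[OF l3]] show ?thesis by simp
  qed
qed

text \<open>After replacing \<open>h\<close> by a Borel representative \<open>k\<close>, the sets over which \<open>k\<close> integrates to zero form a
  Dynkin system that contains all half-lines, hence all Borel sets.\<close>
lemma AE_zero_of_interval_integrals:
  fixes h :: "real \<Rightarrow> real"
  assumes h: "integrable (lebesgue_on {x..y}) h"
    and 0: "\<And>t. x \<le> t \<Longrightarrow> t \<le> y \<Longrightarrow> (LINT s|lebesgue_on {x..t}. h s) = 0"
  shows "AE s in lebesgue_on {x..y}. h s = 0"
proof -
  define F where "F s = indicator {x..y} s * h s" for s
  have F: "integrable lebesgue F"
    using h by (simp add: F_def[abs_def] integrable_restrict_space)
  then have "F \<in> borel_measurable (completion lborel)" by auto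
  from completion_ex_borel_measurable_real[OF this]
  obtain k where k: "k \<in> borel_measurable lborel" and kF: "AE s in lborel. F s = k s" by blast
  have kF': "AE s in lebesgue. F s = k s" using AE_completion[OF kF] .
  have k_int: "integrable lborel k"
  proof -
    have "integrable lebesgue k"
      by (rule integrable_cong_AE_imp[OF F]) (use measurable_completion[OF k] kF' in auto)
    then show ?thesis using k integrable_completion by blast
  qed
  have set_k: "(LINT s:A|lborel. k s) = (LINT s|lebesgue. indicator A s * F s)" if "A \<in> sets borel" for A
  proof -
    have m: "(\<lambda>s. indicator A s * k s) \<in> borel_measurable lborel" using k that by simp
    have "(LINT s:A|lborel. k s) = (LINT s|lebesgue. indicator A s * k s)"
      using integral_completion[OF m] by (simp add: set_lebesgue_integral_def)
    also have "\<dots> = (LINT s|lebesgue. indicator A s * F s)"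
    proof (rule integral_cong_AE)
      show "(\<lambda>s. indicat_real A s * k s) \<in> borel_measurable lebesgue"
        using m by (rule measurable_completion)
      show "(\<lambda>s. indicat_real A s * F s) \<in> borel_measurable lebesgue"
        using F sets_completionI_sets[of A lborel] that
        by (intro borel_measurable_times borel_measurable_indicator) auto
    qed (use kF' in auto)
    finally show ?thesis .
  qed
  have half: "(LINT s|lebesgue. indicator {..t} s * F s) = 0" for t
  proof (cases "x \<le> t")
    case True
    have "indicator {..t} s * F s = indicator {x..min t y} s *\<^sub>R h s" for s
      by (auto simp: F_def indicator_def)
    then have "(LINT s|lebesgue. indicator {..t} s * F s) = (LINT s|lebesgue_on {x..min t y}. h s)"
      by (simp add: integral_restrict_space)
    also have "\<dots> = 0"
    proof (cases "x \<le> y")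
      case True
      then show ?thesis using 0[of "min t y"] \<open>x \<le> t\<close> by auto
    next
      case False
      then have "{x..min t y} = {}" by auto
      then show ?thesis by (simp add: integral_restrict_space)
    qed
    finally show ?thesis .
  next
    case False
    then have "indicator {..t} s * F s = 0" for s by (auto simp: F_def indicator_def)
    then show ?thesis by (simp only: Bochner_Integration.integral_zero)
  qed
  have total: "(LINT s|lborel. k s) = 0"
  proof -
    have "(LINT s|lborel. k s) = (LINT s|lebesgue. F s)"
      using set_k[of UNIV] by (simp add: set_lebesgue_integral_def)
    also have "\<dots> = (LINT s|lebesgue. indicator {..y} s * F s)"
      by (rule Bochner_Integration.integral_cong) (auto simp: F_def indicator_def)
    finally show ?thesis using half by simp
  qed
  have si: "set_integrable lborel A k" if "A \<in> sets borel" for A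
    unfolding set_integrable_def using integrable_mult_indicator[OF _ k_int, of A] that by simp
  have "(LINT s:A|lborel. k s) = 0" if "A \<in> sets borel" for A
  proof -
    have "Int_stable (range (\<lambda>t::real. {..t}))"
      by (auto simp: Int_stable_def)
    moreover have "range (\<lambda>t::real. {..t}) \<subseteq> Pow UNIV" by simp
    moreover have "A \<in> sigma_sets UNIV (range (\<lambda>t::real. {..t}))"
      using that unfolding borel_eq_atMost by (simp add: sets_measure_of)
    ultimately show ?thesis
    proof (induction rule: sigma_sets_induct_disjoint[consumes 3, case_names basic empty compl union])
      case (basic A)
      then show ?case using half set_k by auto
    next
      case empty
      show ?case by (simp add: set_lebesgue_integral_def)
    next
      case (compl A)
      then have A: "A \<in> sets borel" unfolding borel_eq_atMost by (simp add: sets_measure_of)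
      have "(LINT s:(UNIV - A) \<union> A|lborel. k s) = (LINT s:(UNIV - A)|lborel. k s) + (LINT s:A|lborel. k s)"
        by (rule set_integral_Un) (use A si in auto)
      then show ?case using compl total by (simp add: set_lebesgue_integral_def)
    next
      case (union A)
      then have A: "range A \<subseteq> sets borel" unfolding borel_eq_atMost by (auto simp: sets_measure_of)
      have "(LINT s:(\<Union>i. A i)|lborel. k s) = (\<Sum>i. (LINT s:A i|lborel. k s))"
        by (rule lebesgue_integral_countable_add)
           (use A union si in \<open>auto simp: disjoint_family_on_def\<close>)
      then show ?case using union by simp
    qed
  qed
  then have "AE s in lborel. k s = 0"
    by (intro density_unique_real[OF k_int]) auto
  with kF have "AE s in lborel. F s = 0" by eventually_elim simp
  then have "AE s in lebesgue. F s = 0" by (rule AE_completion)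
  then have "AE s in lebesgue. s \<in> {x..y} \<longrightarrow> h s = 0" by eventually_elim (auto simp: F_def)
  then show ?thesis by (simp add: AE_restrict_space_iff)
qed

lemma test_function_deriv_vanishes:
  assumes "\<And>k x. (deriv ^^ k) \<phi> differentiable (at (x::real))" "closed K" "\<And>x. x \<notin> K \<Longrightarrow> \<phi> x = (0::real)"
  shows "x \<notin> K \<Longrightarrow> (deriv ^^ k) \<phi> x = 0"
proof (induction k arbitrary: x)
  case (Suc k)
  have "((deriv ^^ k) \<phi> has_real_derivative 0) (at x)"
    by (rule has_field_derivative_transform_within_open[OF DERIV_const, of "- K"])
       (use Suc assms(2) in \<open>auto simp: open_Compl\<close>)
  then show ?case by (simp add: DERIV_imp_deriv)
qed (use assms(3) in simp)

lemma locally_integrable_mult_test_function: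
  assumes S: "S \<in> sets lebesgue" and f: "locally_integrable S f" and \<phi>: "test_function S \<phi>"
  shows "integrable (lebesgue_on S) (\<lambda>x. f x * (deriv ^^ k) \<phi> x)"
proof -
  define \<psi> where "\<psi> = (deriv ^^ k) \<phi>"
  from \<phi> obtain K where K: "compact K" "K \<subseteq> S" "\<And>x. x \<notin> K \<Longrightarrow> \<phi> x = 0"
    and d: "\<And>k x. (deriv ^^ k) \<phi> differentiable (at x)"
    unfolding test_function_def by blast
  have z: "\<psi> x = 0" if "x \<notin> K" for x
    unfolding \<psi>_def by (rule test_function_deriv_vanishes[OF d compact_imp_closed[OF K(1)] K(3) that])
  have c: "continuous_on A \<psi>" for A
    unfolding \<psi>_def
    by (intro continuous_at_imp_continuous_on ballI differentiable_imp_continuous_within d)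
  have K': "K \<in> sets lebesgue" using compact_imp_closed[OF K(1)] by auto
  from compact_imp_bounded[OF compact_continuous_image[OF c K(1)]]
  obtain B where B: "\<And>x. x \<in> K \<Longrightarrow> \<bar>\<psi> x\<bar> \<le> B" by (auto simp: bounded_iff)
  have fK: "integrable (lebesgue_on K) f" using f K by (auto simp: locally_integrable_def)
  have "integrable (lebesgue_on K) (\<lambda>x. f x * \<psi> x)"
  proof (rule Bochner_Integration.integrable_bound)
    show "integrable (lebesgue_on K) (\<lambda>x. B * f x)" using fK by simp
    show "(\<lambda>x. f x * \<psi> x) \<in> borel_measurable (lebesgue_on K)"
      using fK continuous_imp_measurable_on_sets_lebesgue[OF c K'] by auto
    show "AE x in lebesgue_on K. norm (f x * \<psi> x) \<le> norm (B * f x)"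
    proof (rule AE_I2)
      fix x assume "x \<in> space (lebesgue_on K)"
      then have "\<bar>\<psi> x\<bar> \<le> \<bar>B\<bar>" using B[of x] by (simp add: space_restrict_space) 
      then show "norm (f x * \<psi> x) \<le> norm (B * f x)"
        using mult_left_mono[of "\<bar>\<psi> x\<bar>" "\<bar>B\<bar>" "\<bar>f x\<bar>"] by (simp add: abs_mult mult_ac)
    qed
  qed
  then have "integrable lebesgue (\<lambda>x. indicator K x *\<^sub>R (f x * \<psi> x))"
    using K' by (simp add: integrable_restrict_space)
  also have "(\<lambda>x. indicator K x *\<^sub>R (f x * \<psi> x)) = (\<lambda>x. indicator S x *\<^sub>R (f x * \<psi> x))"
  proof
    fix x show "indicator K x *\<^sub>R (f x * \<psi> x) = indicator S x *\<^sub>R (f x * \<psi> x)"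
      using z[of x] K(2) by (cases "x \<in> K") (auto simp: indicator_def)
  qed
  finally show ?thesis using S by (simp add: integrable_restrict_space \<psi>_def)
qed

lemma has_weak_deriv_diff:
  assumes S: "open S" and f: "has_weak_deriv k S f f'" and g: "has_weak_deriv k S g g'"
  shows "has_weak_deriv k S (\<lambda>x. f x - g x) (\<lambda>x. f' x - g' x)"
  unfolding has_weak_deriv_def
proof (intro conjI allI impI)
  have li: "locally_integrable S f" "locally_integrable S g" "locally_integrable S f'" "locally_integrable S g'"
    using f g by (auto simp: has_weak_deriv_def)
  then show "locally_integrable S (\<lambda>x. f x - g x)" "locally_integrable S (\<lambda>x. f' x - g' x)"
    by (auto simp: locally_integrable_def)
  fix \<phi> assume \<phi>: "test_function S \<phi>"
  have S': "S \<in> sets lebesgue" using S by simp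
  note int = locally_integrable_mult_test_function[OF S' _ \<phi>]
  show "(LINT x|lebesgue_on S. (f x - g x) * (deriv ^^ k) \<phi> x) =
        (-1) ^ k * (LINT x|lebesgue_on S. (f' x - g' x) * \<phi> x)"
    using f g \<phi> int[OF li(1), of k] int[OF li(2), of k] int[OF li(3), of 0] int[OF li(4), of 0]
    by (simp add: left_diff_distrib has_weak_deriv_def right_diff_distrib)
qed

text \<open>The difference of two weak derivatives is a weak derivative of the zero function, so its integrals over
  all compact subintervals vanish; these subintervals exhaust the open interval.\<close>
lemma has_weak_deriv_unique:
  assumes f: "has_weak_deriv 1 {l<..<r} f g" "has_weak_deriv 1 {l<..<r} f h"
  shows "AE x in lebesgue_on {l<..<r}. g x = h x"
proof -
  define d where "d x = g x - h x" for x
  have wd: "has_weak_deriv 1 {l<..<r} (\<lambda>x. 0) d"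
    using has_weak_deriv_diff[OF _ f] by (simp add: d_def[abs_def])
  have "AE x in lebesgue. x \<in> {l + 1 / real (Suc n)..r - 1 / real (Suc n)} \<longrightarrow> d x = 0" for n
  proof -
    let ?x = "l + 1 / real (Suc n)" and ?y = "r - 1 / real (Suc n)"
    have "0 < 1 / real (Suc n)" by simp
    then have sub: "{?x..?y} \<subseteq> {l<..<r}"
      unfolding greaterThanLessThan_iff subset_iff atLeastAtMost_iff by linarith
    have "AE x in lebesgue_on {?x..?y}. d x = 0"
    proof (cases "?x \<le> ?y")
      case True
      show ?thesis
      proof (rule AE_zero_of_interval_integrals)
        show "integrable (lebesgue_on {?x..?y}) d"
          by (rule weak_deriv_integral[OF _ wd _ sub True]) auto
        show "(LINT s|lebesgue_on {?x..t}. d s) = 0" if "?x \<le> t" "t \<le> ?y" for t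
        proof -
          have "{?x..t} \<subseteq> {l<..<r}" using sub that by auto
          from weak_deriv_integral(2)[OF _ wd _ this that(1)] show ?thesis by simp
        qed
      qed
    next
      case False
      then have "{?x..?y} = {}" by auto
      then show ?thesis by (simp add: AE_restrict_space_iff)
    qed
    then show ?thesis by (simp add: AE_restrict_space_iff)
  qed
  then have "AE x in lebesgue. \<forall>n. x \<in> {l + 1 / real (Suc n)..r - 1 / real (Suc n)} \<longrightarrow> d x = 0"
    unfolding AE_all_countable by blast
  then have "AE x in lebesgue. x \<in> {l<..<r} \<longrightarrow> d x = 0"
  proof eventually_elim
    case (elim x)
    show ?case
    proof
      assume x: "x \<in> {l<..<r}"
      then obtain n where "inverse (real (Suc n)) < min (x - l) (r - x)"
        using reals_Archimedean[of "min (x - l) (r - x)"] by auto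
      then have "x \<in> {l + 1 / real (Suc n)..r - 1 / real (Suc n)}"
        by (auto simp: inverse_eq_divide)
      then show "d x = 0" using elim by blast
    qed
  qed
  then show ?thesis by (simp add: AE_restrict_space_iff d_def)
qed

lemma borel_measurable_lebesgue_on_AE:
  fixes f g :: "real \<Rightarrow> real"
  assumes S: "S \<in> sets lebesgue" and f: "f \<in> borel_measurable (lebesgue_on S)"
    and ae: "AE x in lebesgue_on S. f x = g x"
  shows "g \<in> borel_measurable (lebesgue_on S)"
proof -
  have "(\<lambda>x. indicator S x *\<^sub>R g x) \<in> borel_measurable lebesgue"
  proof (rule borel_measurable_AE)
    show "(\<lambda>x. indicator S x *\<^sub>R f x) \<in> borel_measurable lebesgue"
      using f S by (simp add: borel_measurable_restrict_space_iff)
    have "AE x in lebesgue. x \<in> S \<longrightarrow> f x = g x" using ae S by (simp add: AE_restrict_space_iff)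
    then show "AE x in lebesgue. indicator S x *\<^sub>R f x = indicator S x *\<^sub>R g x"
      by eventually_elim (auto simp: indicator_def)
  qed
  then show ?thesis using S by (simp add: borel_measurable_restrict_space_iff)
qed

section \<open>Square-integrable functions and Sobolev spaces\<close>

lemma L2_AE:
  assumes S: "S \<in> sets lebesgue" and f: "f \<in> L2 S" and ae: "AE x in lebesgue_on S. f x = g x"
  shows "g \<in> L2 S"
proof -
  have g: "g \<in> borel_measurable (lebesgue_on S)"
    using borel_measurable_lebesgue_on_AE[OF S _ ae] f by (auto simp: L2_def)
  moreover have "integrable (lebesgue_on S) (\<lambda>x. (g x)\<^sup>2)"
    by (rule integrable_cong_AE_imp[of _ "\<lambda>x. (f x)\<^sup>2"]) (use f g ae in \<open>auto simp: L2_def\<close>)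
  ultimately show ?thesis by (simp add: L2_def)
qed

lemma L2_mult_integrable:
  assumes "f \<in> L2 S" "g \<in> L2 S"
  shows "integrable (lebesgue_on S) (\<lambda>x. f x * g x)"
proof (rule Bochner_Integration.integrable_bound)
  show "integrable (lebesgue_on S) (\<lambda>x. (f x)\<^sup>2 + (g x)\<^sup>2)" using assms by (auto simp: L2_def)
  show "(\<lambda>x. f x * g x) \<in> borel_measurable (lebesgue_on S)" using assms by (auto simp: L2_def)
  have "\<bar>a * b\<bar> \<le> a\<^sup>2 + b\<^sup>2" for a b :: real
  proof -
    have "2 * (\<bar>a\<bar> * \<bar>b\<bar>) \<le> a\<^sup>2 + b\<^sup>2" using sum_squares_bound[of "\<bar>a\<bar>" "\<bar>b\<bar>"] by simp
    moreover have "0 \<le> \<bar>a\<bar> * \<bar>b\<bar>" by simp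
    ultimately show ?thesis unfolding abs_mult by linarith
  qed
  then show "AE x in lebesgue_on S. norm (f x * g x) \<le> norm ((f x)\<^sup>2 + (g x)\<^sup>2)" by simp
qed

lemma L2_diff:
  assumes "f \<in> L2 S" "g \<in> L2 S"
  shows "(\<lambda>x. f x - g x) \<in> L2 S"
proof -
  have "integrable (lebesgue_on S) (\<lambda>x. (f x)\<^sup>2 + (g x)\<^sup>2 - 2 * (f x * g x))"
    using assms L2_mult_integrable[OF assms] by (auto simp: L2_def)
  also have "(\<lambda>x. (f x)\<^sup>2 + (g x)\<^sup>2 - 2 * (f x * g x)) = (\<lambda>x. (f x - g x)\<^sup>2)"
    by (simp add: fun_eq_iff power2_diff)
  finally show ?thesis using assms by (auto simp: L2_def)
qed

lemma L2_cmult: "f \<in> L2 S \<Longrightarrow> (\<lambda>x. c * f x) \<in> L2 S"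
  by (auto simp: L2_def power_mult_distrib)

lemma L2_bounded_mult:
  assumes f: "f \<in> L2 S" and m: "m \<in> borel_measurable (lebesgue_on S)" "\<And>x. x \<in> S \<Longrightarrow> \<bar>m x\<bar> \<le> B"
    and S: "S \<in> sets lebesgue"
  shows "(\<lambda>x. m x * f x) \<in> L2 S"
proof -
  have "integrable (lebesgue_on S) (\<lambda>x. (m x * f x)\<^sup>2)"
  proof (rule Bochner_Integration.integrable_bound)
    show "integrable (lebesgue_on S) (\<lambda>x. B\<^sup>2 * (f x)\<^sup>2)" using f by (auto simp: L2_def)
    show "(\<lambda>x. (m x * f x)\<^sup>2) \<in> borel_measurable (lebesgue_on S)" using f m by (auto simp: L2_def)
    show "AE x in lebesgue_on S. norm ((m x * f x)\<^sup>2) \<le> norm (B\<^sup>2 * (f x)\<^sup>2)"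
    proof (rule AE_I2)
      fix x assume "x \<in> space (lebesgue_on S)"
      then have "\<bar>m x\<bar> \<le> \<bar>B\<bar>" using m(2)[of x] by (simp add: space_restrict_space)
      then have "(m x)\<^sup>2 \<le> B\<^sup>2" by (simp add: abs_le_square_iff)
      then show "norm ((m x * f x)\<^sup>2) \<le> norm (B\<^sup>2 * (f x)\<^sup>2)"
        by (simp add: power_mult_distrib mult_right_mono)
    qed
  qed
  then show ?thesis using f m by (auto simp: L2_def)
qed

lemma L2_norm_square: "(L2_norm S f)\<^sup>2 = (LINT x|lebesgue_on S. (f x)\<^sup>2)"
  by (simp add: L2_norm_def)

lemma L2_norm_nonneg: "0 \<le> L2_norm S f"
  by (simp add: L2_norm_def)

text \<open>The quadratic \<open>t \<mapsto> \<integral> (f - t g)\<^sup>2\<close> is nonnegative, so its discriminant is not positive.\<close>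
lemma L2_Cauchy_Schwarz:
  assumes f: "f \<in> L2 S" and g: "g \<in> L2 S"
  shows "\<bar>LINT x|lebesgue_on S. f x * g x\<bar> \<le> L2_norm S f * L2_norm S g"
proof -
  let ?A = "LINT x|lebesgue_on S. (f x)\<^sup>2" and ?B = "LINT x|lebesgue_on S. f x * g x"
    and ?C = "LINT x|lebesgue_on S. (g x)\<^sup>2"
  have int: "integrable (lebesgue_on S) (\<lambda>x. (f x)\<^sup>2)" "integrable (lebesgue_on S) (\<lambda>x. (g x)\<^sup>2)"
    "integrable (lebesgue_on S) (\<lambda>x. f x * g x)"
    using assms L2_mult_integrable[OF assms] by (auto simp: L2_def)
  have q: "0 \<le> ?A - 2 * t * ?B + t\<^sup>2 * ?C" for t
  proof -
    have "0 \<le> (LINT x|lebesgue_on S. (f x - t * g x)\<^sup>2)" by simp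
    also have "(\<lambda>x. (f x - t * g x)\<^sup>2) = (\<lambda>x. (f x)\<^sup>2 - 2 * t * (f x * g x) + t\<^sup>2 * (g x)\<^sup>2)"
      by (simp add: fun_eq_iff power2_diff power_mult_distrib)
    also have "(LINT x|lebesgue_on S. (f x)\<^sup>2 - 2 * t * (f x * g x) + t\<^sup>2 * (g x)\<^sup>2) = ?A - 2 * t * ?B + t\<^sup>2 * ?C"
      using int by simp
    finally show ?thesis .
  qed
  have "?B\<^sup>2 \<le> ?A * ?C"
  proof (cases "?C = 0")
    case True
    have "?B = 0"
    proof (rule ccontr)
      assume "?B \<noteq> 0"
      then show False using q[of "(?A + 1) / (2 * ?B)"] True by (simp add: field_simps)
    qed
    then show ?thesis using True by simp
  next
    case False
    have "0 \<le> ?C" by simp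
    with False have C: "0 < ?C" by linarith
    have "?A - 2 * (?B / ?C) * ?B + (?B / ?C)\<^sup>2 * ?C = (?A * ?C - ?B\<^sup>2) / ?C"
      using C by (simp add: field_simps power2_eq_square)
    then show ?thesis using q[of "?B / ?C"] C by (simp add: zero_le_divide_iff)
  qed
  then have "sqrt (?B\<^sup>2) \<le> sqrt (?A * ?C)" by (rule real_sqrt_le_mono)
  then show ?thesis by (simp add: L2_norm_def real_sqrt_mult)
qed

lemma L2_norm_diff_le:
  assumes f: "f \<in> L2 S" and g: "g \<in> L2 S"
  shows "L2_norm S (\<lambda>x. f x - g x) \<le> L2_norm S f + L2_norm S g"
proof (rule power2_le_imp_le)
  have int: "integrable (lebesgue_on S) (\<lambda>x. (f x)\<^sup>2)" "integrable (lebesgue_on S) (\<lambda>x. (g x)\<^sup>2)"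
    "integrable (lebesgue_on S) (\<lambda>x. f x * g x)"
    using assms L2_mult_integrable[OF assms] by (auto simp: L2_def)
  have "(\<lambda>x. (f x - g x)\<^sup>2) = (\<lambda>x. (f x)\<^sup>2 + (g x)\<^sup>2 - 2 * (f x * g x))"
    by (simp add: fun_eq_iff power2_diff)
  then have "(L2_norm S (\<lambda>x. f x - g x))\<^sup>2 = (LINT x|lebesgue_on S. (f x)\<^sup>2 + (g x)\<^sup>2 - 2 * (f x * g x))"
    by (simp add: L2_norm_square)
  also have "\<dots> = (L2_norm S f)\<^sup>2 + (L2_norm S g)\<^sup>2 - 2 * (LINT x|lebesgue_on S. f x * g x)"
    using int by (simp add: L2_norm_square)
  also have "\<dots> \<le> (L2_norm S f + L2_norm S g)\<^sup>2"
    using L2_Cauchy_Schwarz[OF f g] by (simp add: power2_sum)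
  finally show "(L2_norm S (\<lambda>x. f x - g x))\<^sup>2 \<le> (L2_norm S f + L2_norm S g)\<^sup>2" .
qed (simp add: L2_norm_nonneg)

lemma weak_deriv_has_weak_deriv:
  "has_weak_deriv k S f g \<Longrightarrow> has_weak_deriv k S f (weak_deriv k S f)"
  unfolding weak_deriv_def by (rule someI[of "has_weak_deriv k S f"])

lemma Hk_weak_deriv:
  assumes "f \<in> Hk k S" "1 \<le> k"
  shows "has_weak_deriv 1 S f (weak_deriv 1 S f)" "weak_deriv 1 S f \<in> L2 S" "f \<in> L2 S"
proof -
  have *: "(\<exists>g. has_weak_deriv 1 S f g) \<and> weak_deriv 1 S f \<in> L2 S"
    using assms unfolding Hk_def by fastforce
  then show "has_weak_deriv 1 S f (weak_deriv 1 S f)"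
    using weak_deriv_has_weak_deriv by blast
  show "weak_deriv 1 S f \<in> L2 S" "f \<in> L2 S" using * assms by (auto simp: Hk_def)
qed

text \<open>The chosen weak derivative of a difference agrees almost everywhere with the difference of the chosen
  weak derivatives. Without this, \<open>Hk_norm\<close> of the difference would bound nothing: the integral of a
  square that is not integrable is \<open>0\<close> by convention.\<close>
lemma Hk_diff_weak_deriv:
  assumes f: "f \<in> Hk k {l<..<r}" and g: "g \<in> Hk k {l<..<r}" and "1 \<le> k"
  shows "has_weak_deriv 1 {l<..<r} (\<lambda>x. f x - g x) (weak_deriv 1 {l<..<r} (\<lambda>x. f x - g x))"
    and "weak_deriv 1 {l<..<r} (\<lambda>x. f x - g x) \<in> L2 {l<..<r}"
    and "(\<lambda>x. f x - g x) \<in> L2 {l<..<r}"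
proof -
  note F = Hk_weak_deriv[OF f \<open>1 \<le> k\<close>] and G = Hk_weak_deriv[OF g \<open>1 \<le> k\<close>]
  have d: "has_weak_deriv 1 {l<..<r} (\<lambda>x. f x - g x) (\<lambda>x. weak_deriv 1 {l<..<r} f x - weak_deriv 1 {l<..<r} g x)"
    by (rule has_weak_deriv_diff[OF _ F(1) G(1)]) simp
  then show w: "has_weak_deriv 1 {l<..<r} (\<lambda>x. f x - g x) (weak_deriv 1 {l<..<r} (\<lambda>x. f x - g x))"
    by (rule weak_deriv_has_weak_deriv)
  show "weak_deriv 1 {l<..<r} (\<lambda>x. f x - g x) \<in> L2 {l<..<r}"
    by (rule L2_AE[OF _ L2_diff[OF F(2) G(2)] has_weak_deriv_unique[OF d w]]) simp
  show "(\<lambda>x. f x - g x) \<in> L2 {l<..<r}" by (rule L2_diff[OF F(3) G(3)])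
qed

section \<open>Indefinite integrals and integration by parts\<close>

lemma integrable_lebesgue_on_open_interval:
  fixes f :: "real \<Rightarrow> real"
  assumes "integrable (lebesgue_on {l<..<r}) f"
  shows "f absolutely_integrable_on {l..r}" "(LINT x|lebesgue_on {l<..<r}. f x) = integral {l..r} f"
proof -
  have "f absolutely_integrable_on {l<..<r}"
    using assms by (simp add: set_integrable_def integrable_restrict_space)
  then show "f absolutely_integrable_on {l..r}"
  proof (rule absolutely_integrable_spike_set)
    show "negligible {x \<in> {l<..<r} - {l..r}. f x \<noteq> 0}"
      by (rule negligible_subset[of "{}"]) auto
    show "negligible {x \<in> {l..r} - {l<..<r}. f x \<noteq> 0}"
      by (rule negligible_subset[of "{l, r}"]) auto
  qed
  show "(LINT x|lebesgue_on {l<..<r}. f x) = integral {l..r} f"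
    using lebesgue_integral_eq_integral[OF assms] by (simp add: integral_open_interval_real)
qed

text \<open>On a compact interval this says that \<open>F\<close> is absolutely continuous with derivative \<open>f\<close> almost everywhere.\<close>
definition primitive_on :: "real \<Rightarrow> real \<Rightarrow> (real \<Rightarrow> real) \<Rightarrow> (real \<Rightarrow> real) \<Rightarrow> bool" where
  "primitive_on l r F f \<longleftrightarrow> f absolutely_integrable_on {l..r} \<and> (\<forall>x\<in>{l..r}. integral {l..x} f = F x - F l)"

lemma primitive_on_diff_eq:
  assumes F: "primitive_on l r F f" and xy: "l \<le> x" "x \<le> y" "y \<le> r"
  shows "integral {x..y} f = F y - F x"
proof -
  have f: "f integrable_on {l..r}"
    using F by (auto simp: primitive_on_def absolutely_integrable_on_def)
  have "integral {l..x} f + integral {x..y} f = integral {l..y} f"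
    by (rule Henstock_Kurzweil_Integration.integral_combine)
       (use xy in \<open>auto intro: integrable_subinterval_real[OF f]\<close>)
  then show ?thesis using F xy by (auto simp: primitive_on_def)
qed

lemma primitive_on_subinterval:
  assumes F: "primitive_on l r F f" and "l \<le> x" "y \<le> r"
  shows "primitive_on x y F f"
  unfolding primitive_on_def
proof
  show "f absolutely_integrable_on {x..y}"
    using F assms by (auto simp: primitive_on_def intro: absolutely_integrable_on_subinterval)
  show "\<forall>z\<in>{x..y}. integral {x..z} f = F z - F x"
    using primitive_on_diff_eq[OF F] assms by auto
qed

lemma primitive_on_continuous:
  assumes F: "primitive_on l r F f"
  shows "continuous_on {l..r} F"
proof -
  have "f integrable_on {l..r}"
    using F by (auto simp: primitive_on_def absolutely_integrable_on_def)
  then have "continuous_on {l..r} (\<lambda>x. F l + integral {l..x} f)"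
    by (intro continuous_intros indefinite_integral_continuous_1)
  then show ?thesis
    by (rule continuous_on_eq) (use F in \<open>auto simp: primitive_on_def\<close>)
qed

lemma primitive_on_mult_integrable:
  assumes F: "continuous_on {l..r} (F::real\<Rightarrow>real)" and g: "g absolutely_integrable_on {l..r}"
  shows "(\<lambda>x. F x * g x) absolutely_integrable_on {l..r}"
proof (rule absolutely_integrable_bounded_measurable_product_real[OF _ _ _ g])
  show "F \<in> borel_measurable (lebesgue_on {l..r})"
    by (rule continuous_imp_measurable_on_sets_lebesgue[OF F]) simp
  show "bounded (F ` {l..r})"
    by (rule compact_imp_bounded[OF compact_continuous_image[OF F]]) simp
qed simp

text \<open>The defect \<open>H x y\<close> of the product rule on \<open>[x, y]\<close> is additive in the interval. On a short interval it equals
  the integral of \<open>(F y - F s) * g s + (G x - G s) * f s\<close> over \<open>s\<close>, so it is at most \<open>e\<close> times the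
  integral of \<open>\<bar>f\<bar> + \<bar>g\<bar>\<close> as soon as \<open>F\<close> and \<open>G\<close> oscillate by at most \<open>e\<close>. Bolzano bisection carries
  this bound to the whole interval, and \<open>e\<close> is arbitrary.\<close>
lemma integration_by_parts_primitive:
  assumes F: "primitive_on l r F f" and G: "primitive_on l r G g" and "l \<le> r"
  shows "integral {l..r} (\<lambda>x. F x * g x + G x * f x) = F r * G r - F l * G l"
proof -
  have cF: "continuous_on {l..r} F" and cG: "continuous_on {l..r} G"
    using F G by (auto intro: primitive_on_continuous)
  have f: "f absolutely_integrable_on {l..r}" and g: "g absolutely_integrable_on {l..r}"
    using F G by (auto simp: primitive_on_def)
  have Fg: "(\<lambda>x. F x * g x) integrable_on {l..r}" and Gf: "(\<lambda>x. G x * f x) integrable_on {l..r}"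
    using primitive_on_mult_integrable[OF cF g] primitive_on_mult_integrable[OF cG f]
    by (auto simp: absolutely_integrable_on_def)
  have FgGf: "(\<lambda>x. F x * g x + G x * f x) integrable_on {l..r}"
    by (intro integrable_add Fg Gf)
  have fi: "f integrable_on {l..r}" "g integrable_on {l..r}"
    using f g by (auto simp: absolutely_integrable_on_def)
  have ab: "(\<lambda>x. \<bar>f x\<bar> + \<bar>g x\<bar>) integrable_on {l..r}"
    using f g by (intro integrable_add) (auto simp: absolutely_integrable_on_def)
  note sub = integrable_subinterval_real
  define I where "I x y = integral {x..y} (\<lambda>x. F x * g x + G x * f x)" for x y
  define A where "A x y = integral {x..y} (\<lambda>x. \<bar>f x\<bar> + \<bar>g x\<bar>)" for x y
  define H where "H x y = F y * G y - F x * G x - I x y" for x y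
  have bound: "\<bar>H l r\<bar> \<le> e * A l r" if e: "e > 0" for e
  proof -
    have "l \<le> l \<and> r \<le> r \<longrightarrow> \<bar>H l r\<bar> \<le> e * A l r"
    proof (rule Bolzano[where P = "\<lambda>x y. l \<le> x \<and> y \<le> r \<longrightarrow> \<bar>H x y\<bar> \<le> e * A x y", OF \<open>l \<le> r\<close>])
      fix a b c :: real
      assume P: "l \<le> a \<and> b \<le> r \<longrightarrow> \<bar>H a b\<bar> \<le> e * A a b" "l \<le> b \<and> c \<le> r \<longrightarrow> \<bar>H b c\<bar> \<le> e * A b c"
        and abc: "a \<le> b" "b \<le> c"
      show "l \<le> a \<and> c \<le> r \<longrightarrow> \<bar>H a c\<bar> \<le> e * A a c"
      proof
        assume lr: "l \<le> a \<and> c \<le> r"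
        have "I a b + I b c = I a c" "A a b + A b c = A a c"
          unfolding I_def A_def using abc lr
          by (auto intro!: Henstock_Kurzweil_Integration.integral_combine sub[OF FgGf] sub[OF ab])
        then have "H a c = H a b + H b c" "e * A a c = e * A a b + e * A b c"
          by (auto simp: H_def distrib_left[symmetric])
        then show "\<bar>H a c\<bar> \<le> e * A a c" using P abc lr by simp
      qed
    next
      fix x :: real assume x: "l \<le> x" "x \<le> r"
      then have xin: "x \<in> {l..r}" by simp
      from e have e2: "e / 2 > 0" by simp
      from cF xin e2 obtain d1 where d1: "d1 > 0" "\<And>s. s \<in> {l..r} \<Longrightarrow> dist s x < d1 \<Longrightarrow> dist (F s) (F x) < e / 2"
        unfolding continuous_on_iff by meson
      from cG xin e2 obtain d2 where d2: "d2 > 0" "\<And>s. s \<in> {l..r} \<Longrightarrow> dist s x < d2 \<Longrightarrow> dist (G s) (G x) < e / 2"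
        unfolding continuous_on_iff by meson
      show "\<exists>d>0. \<forall>a b. a \<le> x \<and> x \<le> b \<and> b - a < d \<longrightarrow> l \<le> a \<and> b \<le> r \<longrightarrow> \<bar>H a b\<bar> \<le> e * A a b"
      proof (intro exI[of _ "min d1 d2"] conjI allI impI)
        show "0 < min d1 d2" using d1 d2 by simp
        fix a b assume abx: "a \<le> x \<and> x \<le> b \<and> b - a < min d1 d2" and lr: "l \<le> a \<and> b \<le> r"
        then have "a \<le> b" by simp
        have near: "dist (F s) (F x) < e / 2" "dist (G s) (G x) < e / 2" if "s \<in> {a..b}" for s
        proof -
          have "s \<in> {l..r}" "dist s x < d1" "dist s x < d2" using that abx lr by (auto simp: dist_real_def)
          then show "dist (F s) (F x) < e / 2" "dist (G s) (G x) < e / 2" using d1 d2 by auto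
        qed
        have osc: "\<bar>F b - F s\<bar> \<le> e" "\<bar>G a - G s\<bar> \<le> e" if "s \<in> {a..b}" for s
        proof -
          have "a \<in> {a..b}" "b \<in> {a..b}" using \<open>a \<le> b\<close> by auto
          note n = near[OF that] near[OF this(1)] near[OF this(2)]
          show "\<bar>F b - F s\<bar> \<le> e" "\<bar>G a - G s\<bar> \<le> e"
            using n unfolding dist_real_def by linarith+
        qed
        note si = fi(1)[THEN sub, of a b] fi(2)[THEN sub, of a b] sub[OF Fg, of a b] sub[OF Gf, of a b] sub[OF ab, of a b]
          sub[OF FgGf, of a b]
        have si': "f integrable_on {a..b}" "g integrable_on {a..b}" "(\<lambda>x. F x * g x + G x * f x) integrable_on {a..b}"
          "(\<lambda>x. \<bar>f x\<bar> + \<bar>g x\<bar>) integrable_on {a..b}"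
          using si lr by auto
        have *: "(\<lambda>s. F b * g s + G a * f s) integrable_on {a..b}"
          using si' by (intro integrable_add integrable_on_mult_right) auto
        have "integral {a..b} (\<lambda>s. F b * g s + G a * f s) = F b * integral {a..b} g + G a * integral {a..b} f"
          using si' by (subst Henstock_Kurzweil_Integration.integral_add) (auto intro: integrable_on_mult_right)
        also have "\<dots> = F b * G b - F a * G a"
        proof -
          have "integral {a..b} f = F b - F a" "integral {a..b} g = G b - G a"
            using primitive_on_diff_eq[OF F, of a b] primitive_on_diff_eq[OF G, of a b] lr \<open>a \<le> b\<close> by auto
          then show ?thesis by (simp only:) (simp add: algebra_simps)
        qed
        finally have "H a b = integral {a..b} (\<lambda>s. F b * g s + G a * f s) - I a b" by (simp add: H_def)
        also have "\<dots> = integral {a..b} (\<lambda>s. (F b * g s + G a * f s) - (F s * g s + G s * f s))"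
          unfolding I_def by (rule Henstock_Kurzweil_Integration.integral_diff[symmetric]) (use si' * in auto)
        also have "norm \<dots> \<le> integral {a..b} (\<lambda>s. e * (\<bar>f s\<bar> + \<bar>g s\<bar>))"
        proof (rule integral_norm_bound_integral)
          show "(\<lambda>s. (F b * g s + G a * f s) - (F s * g s + G s * f s)) integrable_on {a..b}"
            using si' * by (intro integrable_diff) auto
          show "(\<lambda>s. e * (\<bar>f s\<bar> + \<bar>g s\<bar>)) integrable_on {a..b}"
            using si' by (intro integrable_on_mult_right) auto
          fix s assume s: "s \<in> {a..b}"
          have "(F b * g s + G a * f s) - (F s * g s + G s * f s) = (F b - F s) * g s + (G a - G s) * f s"
            by (simp add: algebra_simps)
          also have "norm \<dots> \<le> \<bar>F b - F s\<bar> * \<bar>g s\<bar> + \<bar>G a - G s\<bar> * \<bar>f s\<bar>"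
            using norm_triangle_ineq[of "(F b - F s) * g s" "(G a - G s) * f s"] by (simp add: abs_mult)
          also have "\<dots> \<le> e * \<bar>g s\<bar> + e * \<bar>f s\<bar>"
            using osc[OF s] by (intro add_mono mult_right_mono) auto
          finally show "norm ((F b * g s + G a * f s) - (F s * g s + G s * f s)) \<le> e * (\<bar>f s\<bar> + \<bar>g s\<bar>)"
            by (simp add: algebra_simps)
        qed
        also have "\<dots> = e * A a b" by (simp add: A_def)
        finally show "\<bar>H a b\<bar> \<le> e * A a b" by simp
      qed
    qed
    then show ?thesis by simp
  qed
  have "\<bar>H l r\<bar> \<le> 0"
  proof (rule tendsto_lowerbound)
    show "((\<lambda>e. e * A l r) \<longlongrightarrow> 0) (at_right 0)"
      by (auto intro!: tendsto_eq_intros)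
    show "\<forall>\<^sub>F e in at_right 0. \<bar>H l r\<bar> \<le> e * A l r"
      using bound by (auto simp: eventually_at_filter)
  qed simp
  then show ?thesis by (simp add: H_def I_def)
qed

lemma primitive_on_mult:
  assumes F: "primitive_on l r F f" and G: "primitive_on l r G g"
  shows "primitive_on l r (\<lambda>x. F x * G x) (\<lambda>x. F x * g x + G x * f x)"
  unfolding primitive_on_def
proof
  show "(\<lambda>x. F x * g x + G x * f x) absolutely_integrable_on {l..r}"
    using F G by (intro set_integral_add(1) primitive_on_mult_integrable primitive_on_continuous[OF F]
        primitive_on_continuous[OF G]) (auto simp: primitive_on_def)
  show "\<forall>x\<in>{l..r}. integral {l..x} (\<lambda>x. F x * g x + G x * f x) = F x * G x - F l * G l"
    using integration_by_parts_primitive[OF primitive_on_subinterval[OF F] primitive_on_subinterval[OF G]]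
    by auto
qed

lemma primitive_on_diff:
  assumes F: "primitive_on l r F f" and G: "primitive_on l r G g"
  shows "primitive_on l r (\<lambda>x. F x - G x) (\<lambda>x. f x - g x)"
  unfolding primitive_on_def
proof
  have a: "f absolutely_integrable_on {l..r}" "g absolutely_integrable_on {l..r}"
    using F G by (auto simp: primitive_on_def)
  then show "(\<lambda>x. f x - g x) absolutely_integrable_on {l..r}" by (rule set_integral_diff(1))
  have i: "f integrable_on {l..r}" "g integrable_on {l..r}"
    using a by (auto simp: absolutely_integrable_on_def)
  show "\<forall>x\<in>{l..r}. integral {l..x} (\<lambda>x. f x - g x) = F x - G x - (F l - G l)"
  proof
    fix x assume x: "x \<in> {l..r}"
    have "f integrable_on {l..x}" "g integrable_on {l..x}"
      using x by (auto intro: integrable_subinterval_real[OF i(1)] integrable_subinterval_real[OF i(2)])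
    then show "integral {l..x} (\<lambda>x. f x - g x) = F x - G x - (F l - G l)"
      using F G x by (simp add: Henstock_Kurzweil_Integration.integral_diff primitive_on_def)
  qed
qed

lemma L2_one: "(\<lambda>x. 1) \<in> L2 {l<..<r}"
  using finite_measure.integrable_const[OF finite_measure_lebesgue_on[of "{l<..<r}"], of "1::real"]
  by (auto simp: L2_def)

lemma continuous_imp_L2:
  assumes f: "continuous_on {l..r} f"
  shows "f \<in> L2 {l<..<r}"
proof -
  from compact_imp_bounded[OF compact_continuous_image[OF f compact_Icc]]
  obtain B where B: "\<forall>x\<in>{l..r}. \<bar>f x\<bar> \<le> B" by (auto simp: bounded_iff)
  have "(\<lambda>x. f x * 1) \<in> L2 {l<..<r}"
  proof (rule L2_bounded_mult[OF L2_one])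
    show "f \<in> borel_measurable (lebesgue_on {l<..<r})"
      by (rule continuous_imp_measurable_on_sets_lebesgue[OF continuous_on_subset[OF f]]) auto
  qed (use B in auto)
  then show ?thesis by simp
qed

lemma L2_interval_integral_le:
  assumes f: "f \<in> L2 {l<..<r}" and "l \<le> r"
  shows "f absolutely_integrable_on {l..r}" "integral {l..r} (\<lambda>x. \<bar>f x\<bar>) \<le> sqrt (r - l) * L2_norm {l<..<r} f"
proof -
  note one = L2_one[of l r]
  have n1: "L2_norm {l<..<r} (\<lambda>x. 1) = sqrt (r - l)"
    using \<open>l \<le> r\<close> by (simp add: L2_norm_def measure_restrict_space)
  have "integrable (lebesgue_on {l<..<r}) f" using L2_mult_integrable[OF f one] by simp
  then show "f absolutely_integrable_on {l..r}" by (rule integrable_lebesgue_on_open_interval)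
  have abs: "(\<lambda>x. \<bar>f x\<bar>) \<in> L2 {l<..<r}" using f by (auto simp: L2_def)
  have "integrable (lebesgue_on {l<..<r}) (\<lambda>x. \<bar>f x\<bar>)" using L2_mult_integrable[OF abs one] by simp
  from integrable_lebesgue_on_open_interval(2)[OF this] L2_Cauchy_Schwarz[OF abs one] n1
  show "integral {l..r} (\<lambda>x. \<bar>f x\<bar>) \<le> sqrt (r - l) * L2_norm {l<..<r} f"
    by (simp add: L2_norm_def mult.commute)
qed

text \<open>By \<open>weak_deriv_integral\<close>, \<open>F\<close> and the indefinite integral of \<open>d\<close> differ by a constant on the open
  interval, hence by continuity also on its closure.\<close>
lemma weak_deriv_imp_primitive_on:
  assumes F: "continuous_on {l..r} F" and wd: "has_weak_deriv 1 {l<..<r} F d" and d: "d \<in> L2 {l<..<r}"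
    and "l < r"
  shows "primitive_on l r F d"
proof -
  have di: "d absolutely_integrable_on {l..r}" using L2_interval_integral_le[OF d] \<open>l < r\<close> by simp
  then have d': "d integrable_on {l..r}" by (simp add: absolutely_integrable_on_def)
  define G where "G x = integral {l..x} d" for x
  have G: "continuous_on {l..r} G" unfolding G_def by (rule indefinite_integral_continuous_1[OF d'])
  define m where "m = (l + r) / 2"
  have m: "l < m" "m < r" using \<open>l < r\<close> by (auto simp: m_def)
  have step: "F y - F x = G y - G x" if "l < x" "x \<le> y" "y < r" for x y
  proof -
    have "{x..y} \<subseteq> {l<..<r}" using that by auto
    note W = weak_deriv_integral[OF _ wd continuous_on_subset[OF F] this \<open>x \<le> y\<close>]
    have "F y - F x = integral {x..y} d"
      using W lebesgue_integral_eq_integral[of "{x..y}" d] by (simp add: greaterThanLessThan_subseteq_atLeastAtMost_iff)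
    moreover have "integral {l..x} d + integral {x..y} d = integral {l..y} d"
      by (rule Henstock_Kurzweil_Integration.integral_combine)
         (use that in \<open>auto intro: integrable_subinterval_real[OF d']\<close>)
    ultimately show ?thesis by (simp add: G_def)
  qed
  have const: "F x - G x = F m - G m" if "x \<in> {l<..<r}" for x
    using step[of x m] step[of m x] m that by (cases "x \<le> m") auto
  have cl: "F x - G x = F m - G m" if "x \<in> {l..r}" for x
    by (rule continuous_constant_on_closure[of "{l<..<r}" "\<lambda>x. F x - G x"])
       (use const that \<open>l < r\<close> in \<open>auto intro!: continuous_intros F G\<close>)
  have "integral {l..x} d = F x - F l" if "x \<in> {l..r}" for x
    using cl[OF that] cl[of l] \<open>l < r\<close> by (simp add: G_def)
  then show ?thesis using di by (simp add: primitive_on_def)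
qed

section \<open>Pointwise bounds by the $H^1$ norm\<close>

text \<open>All values of \<open>F\<close> differ by at most the integral of \<open>\<bar>d\<bar>\<close>; integrate this over the second point and apply
  the Cauchy-Schwarz inequality to both integrals.\<close>
lemma sup_le_H1:
  assumes F: "primitive_on l r F d" and d: "d \<in> L2 {l<..<r}" and FL: "F \<in> L2 {l<..<r}"
    and "l < r" and x: "x \<in> {l..r}"
  shows "\<bar>F x\<bar> \<le> L2_norm {l<..<r} F / sqrt (r - l) + sqrt (r - l) * L2_norm {l<..<r} d"
proof -
  have lr: "l \<le> r" using \<open>l < r\<close> by simp
  define D where "D = integral {l..r} (\<lambda>x. \<bar>d x\<bar>)"
  note dD = L2_interval_integral_le[OF d lr] and FD = L2_interval_integral_le[OF FL lr]
  have di: "d integrable_on {l..r}" "(\<lambda>x. \<bar>d x\<bar>) integrable_on {l..r}"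
    and Fi: "(\<lambda>x. \<bar>F x\<bar>) integrable_on {l..r}"
    using dD(1) FD(1) by (auto simp: absolutely_integrable_on_def)
  have osc: "\<bar>F b - F a\<bar> \<le> D" if "l \<le> a" "a \<le> b" "b \<le> r" for a b
  proof -
    have "norm (integral {a..b} d) \<le> integral {a..b} (\<lambda>x. \<bar>d x\<bar>)"
      by (rule integral_norm_bound_integral) (use that in \<open>auto intro: integrable_subinterval_real[OF di(1)]
          integrable_subinterval_real[OF di(2)]\<close>)
    also have "\<dots> \<le> D" unfolding D_def
      by (rule integral_subset_le) (use that di in \<open>auto intro: integrable_subinterval_real[OF di(2)]\<close>)
    finally show ?thesis using primitive_on_diff_eq[OF F that] by simp
  qed
  have le: "\<bar>F x\<bar> - D \<le> \<bar>F y\<bar>" if "y \<in> {l..r}" for y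
    using osc[of x y] osc[of y x] x that by (cases "x \<le> y") auto
  have "integral {l..r} (\<lambda>y. \<bar>F x\<bar> - D) \<le> integral {l..r} (\<lambda>y. \<bar>F y\<bar>)"
    by (rule integral_le) (use le Fi in auto)
  then have "(r - l) * (\<bar>F x\<bar> - D) \<le> sqrt (r - l) * L2_norm {l<..<r} F"
    using FD(2) lr by simp
  then have "\<bar>F x\<bar> - D \<le> sqrt (r - l) * L2_norm {l<..<r} F / (r - l)"
    using \<open>l < r\<close> by (simp add: field_simps)
  also have "\<dots> = L2_norm {l<..<r} F * (sqrt (r - l) / (r - l))" by simp
  also have "\<dots> = L2_norm {l<..<r} F / sqrt (r - l)"
    using \<open>l < r\<close> sqrt_divide_self_eq[of "r - l"] by (simp add: divide_inverse)
  finally show ?thesis using dD(2) by (simp add: D_def)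
qed

lemma L2_norms_le_Hk_norm:
  assumes "1 \<le> k"
  shows "L2_norm S f \<le> Hk_norm k S f" "L2_norm S (weak_deriv 1 S f) \<le> Hk_norm k S f"
proof -
  have s: "(L2_norm S (weak_deriv 1 S f))\<^sup>2 \<le> (\<Sum>j=1..k. (L2_norm S (weak_deriv j S f))\<^sup>2)"
    by (rule member_le_sum) (use assms in auto)
  have "0 \<le> (\<Sum>j=1..k. (L2_norm S (weak_deriv j S f))\<^sup>2)" by (rule sum_nonneg) simp
  then show "L2_norm S f \<le> Hk_norm k S f"
    unfolding Hk_norm_def by (intro real_le_rsqrt) simp
  show "L2_norm S (weak_deriv 1 S f) \<le> Hk_norm k S f"
    unfolding Hk_norm_def by (intro real_le_rsqrt) (use s in \<open>simp add: add_increasing\<close>)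
qed

lemma Hk_diff_sup_le:
  assumes f: "f \<in> Hk k {l<..<r}" and g: "g \<in> Hk k {l<..<r}" and k: "1 \<le> k" and "l < r"
    and c: "continuous_on {l..r} (\<lambda>x. f x - g x)" and x: "x \<in> {l..r}"
  shows "\<bar>f x - g x\<bar> \<le> (1 / sqrt (r - l) + sqrt (r - l)) * Hk_norm k {l<..<r} (\<lambda>x. f x - g x)"
proof -
  let ?S = "{l<..<r}" and ?h = "\<lambda>x. f x - g x"
  note W = Hk_diff_weak_deriv[OF f g k]
  have "\<bar>f x - g x\<bar> \<le> L2_norm ?S ?h / sqrt (r - l) + sqrt (r - l) * L2_norm ?S (weak_deriv 1 ?S ?h)"
    by (rule sup_le_H1[OF weak_deriv_imp_primitive_on[OF c W(1,2) \<open>l < r\<close>] W(2,3) \<open>l < r\<close> x])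
  also have "\<dots> \<le> Hk_norm k ?S ?h / sqrt (r - l) + sqrt (r - l) * Hk_norm k ?S ?h"
    using L2_norms_le_Hk_norm[OF k, of ?S ?h] \<open>l < r\<close>
    by (intro add_mono divide_right_mono mult_left_mono) auto
  finally show ?thesis by (simp add: algebra_simps)
qed

text \<open>Point evaluation is bounded by the $H^1$ norm, so a continuous curve in $H^1$ has continuous traces.\<close>
lemma C0_valued_H1_trace_continuous:
  assumes v: "C0_valued (Hk 1 {l<..<r}) (Hk_norm 1 {l<..<r}) J v" and "l < r"
    and c: "\<And>t. t \<in> J \<Longrightarrow> continuous_on {l..r} (v t)" and x: "x \<in> {l..r}"
  shows "continuous_on J (\<lambda>t. v t x)"
  unfolding continuous_on_def
proof
  fix t assume t: "t \<in> J"
  define C where "C = 1 / sqrt (r - l) + sqrt (r - l)"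
  have "((\<lambda>s. v s x - v t x) \<longlongrightarrow> 0) (at t within J)"
  proof (rule Lim_null_comparison)
    have "((\<lambda>s. C * Hk_norm 1 {l<..<r} (\<lambda>x. v s x - v t x)) \<longlongrightarrow> C * 0) (at t within J)"
      using v t by (intro tendsto_intros) (auto simp: C0_valued_def)
    then show "((\<lambda>s. C * Hk_norm 1 {l<..<r} (\<lambda>x. v s x - v t x)) \<longlongrightarrow> 0) (at t within J)" by simp
    show "\<forall>\<^sub>F s in at t within J. norm (v s x - v t x) \<le> C * Hk_norm 1 {l<..<r} (\<lambda>x. v s x - v t x)"
      unfolding eventually_at_filter real_norm_def C_def
    proof (rule always_eventually, intro allI impI)
      fix s assume s: "s \<noteq> t" "s \<in> J"
      show "\<bar>v s x - v t x\<bar> \<le> (1 / sqrt (r - l) + sqrt (r - l)) * Hk_norm 1 {l<..<r} (\<lambda>x. v s x - v t x)"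
        by (rule Hk_diff_sup_le[OF _ _ _ \<open>l < r\<close> continuous_on_diff[OF c[OF s(2)] c[OF t]] x])
           (use v s t in \<open>auto simp: C0_valued_def\<close>)
    qed
  qed
  then show "((\<lambda>t. v t x) \<longlongrightarrow> v t x) (at t within J)" by (rule LIM_zero_cancel)
qed

section \<open>Time derivatives of $L^2$ products\<close>

lemma L2_norm_mono:
  assumes f: "f \<in> L2 S" and g: "g \<in> L2 S" and le: "\<And>x. x \<in> S \<Longrightarrow> \<bar>f x\<bar> \<le> \<bar>g x\<bar>"
  shows "L2_norm S f \<le> L2_norm S g"
proof -
  have "(LINT x|lebesgue_on S. (f x)\<^sup>2) \<le> (LINT x|lebesgue_on S. (g x)\<^sup>2)"
  proof (rule integral_mono)
    fix x assume "x \<in> space (lebesgue_on S)"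
    then show "(f x)\<^sup>2 \<le> (g x)\<^sup>2" using le[of x] by (simp add: abs_le_square_iff space_restrict_space)
  qed (use f g in \<open>auto simp: L2_def\<close>)
  then show ?thesis by (simp add: L2_norm_def)
qed

lemma L2_norm_cmult: "L2_norm S (\<lambda>x. c * f x) = \<bar>c\<bar> * L2_norm S f"
  by (simp add: L2_norm_def power_mult_distrib real_sqrt_mult)

lemma L2_Cauchy_Schwarz_weighted:
  assumes f: "f \<in> L2 S" and g: "g \<in> L2 S" and S: "S \<in> sets lebesgue"
    and m: "m \<in> borel_measurable (lebesgue_on S)" "\<And>x. x \<in> S \<Longrightarrow> \<bar>m x\<bar> \<le> 1"
  shows "integrable (lebesgue_on S) (\<lambda>x. m x * (f x * g x))"
    and "\<bar>LINT x|lebesgue_on S. m x * (f x * g x)\<bar> \<le> L2_norm S f * L2_norm S g"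
proof -
  have mf: "(\<lambda>x. m x * f x) \<in> L2 S" by (rule L2_bounded_mult[OF f m S])
  show "integrable (lebesgue_on S) (\<lambda>x. m x * (f x * g x))"
    using L2_mult_integrable[OF mf g] by (simp add: mult.assoc)
  have "\<bar>LINT x|lebesgue_on S. (m x * f x) * g x\<bar> \<le> L2_norm S (\<lambda>x. m x * f x) * L2_norm S g"
    by (rule L2_Cauchy_Schwarz[OF mf g])
  also have "\<dots> \<le> L2_norm S f * L2_norm S g"
  proof (intro mult_right_mono L2_norm_nonneg L2_norm_mono mf f)
    fix x assume "x \<in> S"
    then show "\<bar>m x * f x\<bar> \<le> \<bar>f x\<bar>" using m(2)[of x] by (simp add: abs_mult mult_left_le_one_le)
  qed
  finally show "\<bar>LINT x|lebesgue_on S. m x * (f x * g x)\<bar> \<le> L2_norm S f * L2_norm S g"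
    by (simp add: mult.assoc)
qed

lemma C1_valued_L2_tendsto:
  assumes v: "C1_valued (L2 S) (L2_norm S) J v v'" and t: "t \<in> J"
  shows "((\<lambda>s. L2_norm S (\<lambda>x. v s x - v t x)) \<longlongrightarrow> 0) (at t within J)"
proof (rule tendsto_sandwich[where f = "\<lambda>_. 0"])
  let ?q = "\<lambda>s. L2_norm S (\<lambda>x. (v s x - v t x) / (s - t) - v' t x)"
  have L: "v s \<in> L2 S" "v' s \<in> L2 S" if "s \<in> J" for s
    using v that by (auto simp: C1_valued_def C0_valued_def)
  have q: "(?q \<longlongrightarrow> 0) (at t within J)" using v t by (auto simp: C1_valued_def)
  have "((\<lambda>s. \<bar>s - t\<bar> * (?q s + L2_norm S (v' t))) \<longlongrightarrow> \<bar>t - t\<bar> * (0 + L2_norm S (v' t))) (at t within J)"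
    by (intro tendsto_intros q)
  then show "((\<lambda>s. \<bar>s - t\<bar> * (?q s + L2_norm S (v' t))) \<longlongrightarrow> 0) (at t within J)" by simp
  show "\<forall>\<^sub>F s in at t within J. L2_norm S (\<lambda>x. v s x - v t x) \<le> \<bar>s - t\<bar> * (?q s + L2_norm S (v' t))"
    unfolding eventually_at_filter
  proof (rule always_eventually, intro allI impI)
    fix s assume s: "s \<noteq> t" "s \<in> J"
    define D where "D x = (v s x - v t x) / (s - t) - v' t x" for x
    have D: "D \<in> L2 S"
      using L2_diff[OF L2_cmult[OF L2_diff[OF L(1)[OF s(2)] L(1)[OF t]], of "1 / (s - t)"] L(2)[OF t]]
      by (simp add: D_def[abs_def] divide_inverse mult.commute)
    have "v s x - v t x = (s - t) * (D x - (- 1) * v' t x)" for x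
      using s by (simp add: D_def)
    then have "L2_norm S (\<lambda>x. v s x - v t x) = L2_norm S (\<lambda>x. (s - t) * (D x - (- 1) * v' t x))"
      by simp
    also have "\<dots> = \<bar>s - t\<bar> * L2_norm S (\<lambda>x. D x - (- 1) * v' t x)" by (rule L2_norm_cmult)
    also have "\<dots> \<le> \<bar>s - t\<bar> * (L2_norm S D + L2_norm S (v' t))"
      using L2_norm_diff_le[OF D L2_cmult[OF L(2)[OF t], of "- 1"]] L2_norm_cmult[of S "-1" "v' t"]
      by (intro mult_left_mono) auto
    finally show "L2_norm S (\<lambda>x. v s x - v t x) \<le> \<bar>s - t\<bar> * (?q s + L2_norm S (v' t))"
      by (simp add: D_def[abs_def])
  qed
qed (auto simp: L2_norm_nonneg)

lemma C1_valued_diff: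
  assumes p: "C1_valued (L2 S) (L2_norm S) J p p'" and q: "C1_valued (L2 S) (L2_norm S) J q q'"
  shows "C1_valued (L2 S) (L2_norm S) J (\<lambda>t x. p t x - q t x) (\<lambda>t x. p' t x - q' t x)"
proof -
  have P: "p t \<in> L2 S" "p' t \<in> L2 S" and Q: "q t \<in> L2 S" "q' t \<in> L2 S" if "t \<in> J" for t
    using p q that by (auto simp: C1_valued_def C0_valued_def)
  have quot: "(\<lambda>x. (v s x - v t x) / (s - t) - v' t x) \<in> L2 S"
    if "v s \<in> L2 S" "v t \<in> L2 S" "v' t \<in> L2 S" for v v' :: "real \<Rightarrow> real \<Rightarrow> real" and s t
    using L2_diff[OF L2_cmult[OF L2_diff[OF that(1,2)], of "1 / (s - t)"] that(3)]
    by (simp add: divide_inverse mult.commute)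
  have lim: "((\<lambda>s. L2_norm S (h s)) \<longlongrightarrow> 0) (at t within J)"
    if t: "t \<in> J" and f: "((\<lambda>s. L2_norm S (f s)) \<longlongrightarrow> 0) (at t within J)"
      and g: "((\<lambda>s. L2_norm S (g s)) \<longlongrightarrow> 0) (at t within J)"
      and L: "\<And>s. s \<in> J \<Longrightarrow> f s \<in> L2 S" "\<And>s. s \<in> J \<Longrightarrow> g s \<in> L2 S"
      and h: "\<And>s x. h s x = f s x - g s x"
    for t f g h
  proof (rule tendsto_sandwich[where f = "\<lambda>_. 0"])
    show "((\<lambda>s. L2_norm S (f s) + L2_norm S (g s)) \<longlongrightarrow> 0) (at t within J)"
      using tendsto_add[OF f g] by simp
    show "\<forall>\<^sub>F s in at t within J. L2_norm S (h s) \<le> L2_norm S (f s) + L2_norm S (g s)"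
      unfolding eventually_at_filter h[abs_def]
      by (rule always_eventually) (auto intro: L2_norm_diff_le L)
  qed (auto simp: L2_norm_nonneg)
  show ?thesis
    unfolding C1_valued_def C0_valued_def
  proof (intro conjI ballI)
    fix t assume t: "t \<in> J"
    show "(\<lambda>x. p t x - q t x) \<in> L2 S" "(\<lambda>x. p' t x - q' t x) \<in> L2 S"
      using P Q t by (auto intro: L2_diff)
    show "((\<lambda>s. L2_norm S (\<lambda>x. (p' s x - q' s x) - (p' t x - q' t x))) \<longlongrightarrow> 0) (at t within J)"
    proof (rule lim[OF t])
      show "((\<lambda>s. L2_norm S (\<lambda>x. p' s x - p' t x)) \<longlongrightarrow> 0) (at t within J)"
        "((\<lambda>s. L2_norm S (\<lambda>x. q' s x - q' t x)) \<longlongrightarrow> 0) (at t within J)"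
        using p q t by (auto simp: C1_valued_def C0_valued_def)
    qed (use P Q t in \<open>auto intro: L2_diff\<close>)
    show "((\<lambda>s. L2_norm S (\<lambda>x. ((p s x - q s x) - (p t x - q t x)) / (s - t) - (p' t x - q' t x))) \<longlongrightarrow> 0)
        (at t within J)"
    proof (rule lim[OF t])
      show "((\<lambda>s. L2_norm S (\<lambda>x. (p s x - p t x) / (s - t) - p' t x)) \<longlongrightarrow> 0) (at t within J)"
        "((\<lambda>s. L2_norm S (\<lambda>x. (q s x - q t x) / (s - t) - q' t x)) \<longlongrightarrow> 0) (at t within J)"
        using p q t by (auto simp: C1_valued_def)
      show "((p s x - q s x) - (p t x - q t x)) / (s - t) - (p' t x - q' t x) =
          ((p s x - p t x) / (s - t) - p' t x) - ((q s x - q t x) / (s - t) - q' t x)" for s x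
        by (simp add: diff_divide_distrib)
    qed (use P Q t quot in auto)
  qed
qed

text \<open>This is the product rule for the bounded bilinear form \<open>B\<close> given by the weight \<open>m\<close>. The difference quotient
  of \<open>B (v s) (w s)\<close> minus the claimed derivative is a sum of terms, each with a factor that tends to
  zero in $L^2$.\<close>
lemma weighted_L2_product_has_derivative:
  assumes v: "C1_valued (L2 S) (L2_norm S) J v v'" and w: "C1_valued (L2 S) (L2_norm S) J w w'"
    and t: "t \<in> J" and S: "S \<in> sets lebesgue"
    and m: "m \<in> borel_measurable (lebesgue_on S)" "\<And>x. x \<in> S \<Longrightarrow> \<bar>m x\<bar> \<le> 1"
  shows "((\<lambda>t. LINT x|lebesgue_on S. m x * (v t x * w t x)) has_real_derivative
    (LINT x|lebesgue_on S. m x * (v' t x * w t x)) + (LINT x|lebesgue_on S. m x * (v t x * w' t x)))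
    (at t within J)"
proof -
  define B where "B f g = (LINT x|lebesgue_on S. m x * (f x * g x))" for f g :: "real \<Rightarrow> real"
  define N where "N = L2_norm S"
  define Dv where "Dv s x = (v s x - v t x) / (s - t) - v' t x" for s x
  define Dw where "Dw s x = (w s x - w t x) / (s - t) - w' t x" for s x
  have V: "v s \<in> L2 S" "v' s \<in> L2 S" and W: "w s \<in> L2 S" "w' s \<in> L2 S" if "s \<in> J" for s
    using v w that by (auto simp: C1_valued_def C0_valued_def)
  have D: "Dv s \<in> L2 S" "Dw s \<in> L2 S" if "s \<in> J" for s
    using L2_diff[OF L2_cmult[OF L2_diff[OF V(1)[OF that] V(1)[OF t]], of "1 / (s - t)"] V(2)[OF t]]
      L2_diff[OF L2_cmult[OF L2_diff[OF W(1)[OF that] W(1)[OF t]], of "1 / (s - t)"] W(2)[OF t]]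
    by (simp_all add: Dv_def[abs_def] Dw_def[abs_def] divide_inverse mult.commute)
  note int = L2_Cauchy_Schwarz_weighted(1)[OF _ _ S m]
  have CS: "\<bar>B f g\<bar> \<le> N f * N g" if "f \<in> L2 S" "g \<in> L2 S" for f g
    unfolding B_def N_def by (rule L2_Cauchy_Schwarz_weighted(2)[OF that S m])
  have lv: "((\<lambda>s. N (Dv s)) \<longlongrightarrow> 0) (at t within J)" and lw: "((\<lambda>s. N (Dw s)) \<longlongrightarrow> 0) (at t within J)"
    using v w t by (auto simp: C1_valued_def N_def Dv_def[abs_def] Dw_def[abs_def])
  have ld: "((\<lambda>s. N (\<lambda>x. w s x - w t x)) \<longlongrightarrow> 0) (at t within J)"
    unfolding N_def by (rule C1_valued_L2_tendsto[OF w t])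
  let ?bd = "\<lambda>s. N (Dv s) * (N (\<lambda>x. w s x - w t x) + N (w t)) + N (v' t) * N (\<lambda>x. w s x - w t x)
    + N (v t) * N (Dw s)"
  have bd: "(?bd \<longlongrightarrow> 0 * (0 + N (w t)) + N (v' t) * 0 + N (v t) * 0) (at t within J)"
    by (intro tendsto_intros lv lw ld)
  have "\<forall>\<^sub>F s in at t within J.
    \<bar>(B (v s) (w s) - B (v t) (w t)) / (s - t) - (B (v' t) (w t) + B (v t) (w' t))\<bar> \<le> ?bd s"
    unfolding eventually_at_filter
  proof (rule always_eventually, intro allI impI)
    fix s assume s: "s \<noteq> t" "s \<in> J"
    let ?d = "\<lambda>x. w s x - w t x"
    have d: "?d \<in> L2 S" using W s t by (auto intro: L2_diff)
    note i = int[OF V(1)[OF s(2)] W(1)[OF s(2)]] int[OF V(1)[OF t] W(1)[OF t]]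
      int[OF D(1)[OF s(2)] d] int[OF D(1)[OF s(2)] W(1)[OF t]] int[OF V(2)[OF t] d]
      int[OF V(2)[OF t] W(1)[OF t]] int[OF V(1)[OF t] D(2)[OF s(2)]] int[OF V(1)[OF t] W(2)[OF t]]
    have "(B (v s) (w s) - B (v t) (w t)) / (s - t) =
        (LINT x|lebesgue_on S. (m x * (v s x * w s x) - m x * (v t x * w t x)) / (s - t))"
      unfolding B_def by (simp only: integral_divide_zero Bochner_Integration.integral_diff[OF i(1,2)])
    also have "(\<lambda>x. (m x * (v s x * w s x) - m x * (v t x * w t x)) / (s - t)) =
        (\<lambda>x. m x * (Dv s x * ?d x) + m x * (Dv s x * w t x) + m x * (v' t x * ?d x) + m x * (v' t x * w t x)
          + m x * (v t x * Dw s x) + m x * (v t x * w' t x))"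
    proof
      fix x
      have expand: "m * ((a + a') * (d + w) + v * (b + b')) =
          m * (a * d) + m * (a * w) + m * (a' * d) + m * (a' * w) + m * (v * b) + m * (v * b')"
        for m a a' d w v b b' :: real by (simp add: algebra_simps)
      have quot: "(m * (a * b) - m * (a' * b')) / h = m * ((a - a') / h * ((b - b') + b') + a' * ((b - b') / h))"
        for m a a' b b' h :: real by (cases "h = 0") (simp_all add: field_simps)
      have "(v s x - v t x) / (s - t) = Dv s x + v' t x" "(w s x - w t x) / (s - t) = Dw s x + w' t x"
        by (simp_all add: Dv_def Dw_def)
      then show "(m x * (v s x * w s x) - m x * (v t x * w t x)) / (s - t) =
        m x * (Dv s x * ?d x) + m x * (Dv s x * w t x) + m x * (v' t x * ?d x) + m x * (v' t x * w t x)
          + m x * (v t x * Dw s x) + m x * (v t x * w' t x)"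
        by (simp only: quot expand)
    qed
    also have "(LINT x|lebesgue_on S. m x * (Dv s x * ?d x) + m x * (Dv s x * w t x) + m x * (v' t x * ?d x)
        + m x * (v' t x * w t x) + m x * (v t x * Dw s x) + m x * (v t x * w' t x)) =
        B (Dv s) ?d + B (Dv s) (w t) + B (v' t) ?d + B (v' t) (w t) + B (v t) (Dw s) + B (v t) (w' t)"
      unfolding B_def by (simp only: Bochner_Integration.integral_add Bochner_Integration.integrable_add i)
    finally have eq: "(B (v s) (w s) - B (v t) (w t)) / (s - t) - (B (v' t) (w t) + B (v t) (w' t)) =
        B (Dv s) ?d + B (Dv s) (w t) + B (v' t) ?d + B (v t) (Dw s)" by simp
    have "\<bar>B (Dv s) ?d\<bar> \<le> N (Dv s) * N ?d" "\<bar>B (Dv s) (w t)\<bar> \<le> N (Dv s) * N (w t)"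
      "\<bar>B (v' t) ?d\<bar> \<le> N (v' t) * N ?d" "\<bar>B (v t) (Dw s)\<bar> \<le> N (v t) * N (Dw s)"
      using D V W s t d by (auto intro: CS)
    then show "\<bar>(B (v s) (w s) - B (v t) (w t)) / (s - t) - (B (v' t) (w t) + B (v t) (w' t))\<bar> \<le> ?bd s"
      unfolding eq distrib_left by linarith
  qed
  moreover have "(?bd \<longlongrightarrow> 0) (at t within J)" using bd by simp
  ultimately have "((\<lambda>s. (B (v s) (w s) - B (v t) (w t)) / (s - t) - (B (v' t) (w t) + B (v t) (w' t))) \<longlongrightarrow> 0)
      (at t within J)"
    unfolding real_norm_def[symmetric] by (rule Lim_null_comparison)
  from LIM_zero_cancel[OF this] show ?thesis
    unfolding has_field_derivative_iff B_def .
qed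

section \<open>Energy and multiplier estimate for the wave system\<close>

text \<open>The energy \<open>e\<close> of the wave system with source \<open>f\<close> is bounded by a Gronwall argument; the multiplier
  \<open>m x = 2 * x - 1\<close> equals \<open>-1\<close> and \<open>1\<close> at the ends of the interval, so integrating
  \<open>m * (w * wx + r * rx)\<close> by parts produces both squared traces of \<open>r\<close> with the same sign.\<close>
lemma energy_and_multiplier_estimate:
  fixes r w r' w' rx wx f :: "real \<Rightarrow> real \<Rightarrow> real" and T k \<delta> :: real
  assumes T: "T > 0" and k: "k \<ge> 0"
    and r: "C1_valued (L2 {0<..<1}) (L2_norm {0<..<1}) {0..T} r r'"
    and w: "C1_valued (L2 {0<..<1}) (L2_norm {0<..<1}) {0..T} w w'"
    and prim: "\<And>t. t \<in> {0..T} \<Longrightarrow> primitive_on 0 1 (r t) (rx t)" "\<And>t. t \<in> {0..T} \<Longrightarrow> primitive_on 0 1 (w t) (wx t)"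
    and rxL: "\<And>t. t \<in> {0..T} \<Longrightarrow> rx t \<in> L2 {0<..<1}" and wxL: "\<And>t. t \<in> {0..T} \<Longrightarrow> wx t \<in> L2 {0<..<1}"
    and eq: "\<And>t. t \<in> {0<..<T} \<Longrightarrow> AE x in lebesgue_on {0<..<1}. r' t x = - wx t x \<and> w' t x = - rx t x - f t x"
    and fL: "\<And>t. t \<in> {0<..<T} \<Longrightarrow> f t \<in> L2 {0<..<1}"
    and fb: "\<And>t x. t \<in> {0<..<T} \<Longrightarrow> x \<in> {0<..<1} \<Longrightarrow> \<bar>f t x\<bar> \<le> k * \<bar>w t x\<bar> + \<delta>"
    and bc: "\<And>t. t \<in> {0..T} \<Longrightarrow> w t 0 = 0 \<and> w t 1 = 0"
    and ic: "\<And>x. x \<in> {0..1} \<Longrightarrow> r 0 x = 0 \<and> w 0 x = 0"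
    and trace: "continuous_on {0..T} (\<lambda>t. r t 0)" "continuous_on {0..T} (\<lambda>t. r t 1)"
  shows "integral {0..T} (\<lambda>t. (r t 0)\<^sup>2 + (r t 1)\<^sup>2) \<le>
    (T * ((k + 3) * T * exp ((2 * k + 1) * T) + 1) + T * exp ((2 * k + 1) * T)) * \<delta>\<^sup>2"
proof -
  let ?S = "{0<..<1::real}"
  define K where "K = 2 * k + 1"
  have K: "K \<ge> 1" using k by (simp add: K_def)
  define J where "J g = (LINT x|lebesgue_on ?S. g x)" for g :: "real \<Rightarrow> real"
  define m where "m x = 2 * x - 1" for x :: real
  define e where "e t = J (\<lambda>x. 1 * (r t x * r t x)) + J (\<lambda>x. 1 * (w t x * w t x))" for t
  define M where "M t = J (\<lambda>x. m x * (r t x * w t x))" for t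
  have mm: "m \<in> borel_measurable (lebesgue_on ?S)"
    unfolding m_def by (intro continuous_imp_measurable_on_sets_lebesgue continuous_intros) auto
  have mb: "\<bar>m x\<bar> \<le> 1" if "x \<in> ?S" for x using that by (auto simp: m_def abs_le_iff)
  have RW: "r t \<in> L2 ?S" "r' t \<in> L2 ?S" "w t \<in> L2 ?S" "w' t \<in> L2 ?S" if "t \<in> {0..T}" for t
    using r w that by (auto simp: C1_valued_def C0_valued_def)
  have meas: "g \<in> borel_measurable (lebesgue_on ?S)" if "g \<in> L2 ?S" for g using that by (simp add: L2_def)
  note prod = L2_mult_integrable
  have mprod: "integrable (lebesgue_on ?S) (\<lambda>x. m x * (g x * h x))" if "g \<in> L2 ?S" "h \<in> L2 ?S" for g h
    by (rule L2_Cauchy_Schwarz_weighted(1)[OF that _ mm mb]) auto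
  have J_integral: "J g = integral {0..1} g" if "integrable (lebesgue_on ?S) g" for g
    unfolding J_def by (rule integrable_lebesgue_on_open_interval(2)[OF that])
  have J1: "J (\<lambda>x. c) = c" for c by (simp add: J_def measure_restrict_space)
  have ci: "integrable (lebesgue_on ?S) (\<lambda>x. c)" for c :: real
    using prod[OF L2_cmult[OF L2_one[of 0 1], of c] L2_one[of 0 1]] by simp
  have e_eq: "e t = J (\<lambda>x. (r t x)\<^sup>2 + (w t x)\<^sup>2)" if "t \<in> {0..T}" for t
    unfolding e_def J_def using RW[OF that] by (simp add: L2_def power2_eq_square)
  have J_le: "J g \<le> A * e t + \<delta>\<^sup>2"
    if t: "t \<in> {0..T}" and g: "integrable (lebesgue_on ?S) g"
      and le: "\<And>x. x \<in> ?S \<Longrightarrow> g x \<le> A * ((r t x)\<^sup>2 + (w t x)\<^sup>2) + \<delta>\<^sup>2" for t g A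
  proof -
    have i: "integrable (lebesgue_on ?S) (\<lambda>x. (r t x)\<^sup>2 + (w t x)\<^sup>2)" using RW[OF t] by (simp add: L2_def)
    have "J g \<le> J (\<lambda>x. A * ((r t x)\<^sup>2 + (w t x)\<^sup>2) + \<delta>\<^sup>2)"
      unfolding J_def
      by (rule integral_mono[OF g]) (use i ci le in \<open>auto simp: space_restrict_space\<close>)
    also have "\<dots> = A * J (\<lambda>x. (r t x)\<^sup>2 + (w t x)\<^sup>2) + J (\<lambda>x. \<delta>\<^sup>2)"
      unfolding J_def by (subst Bochner_Integration.integral_add) (use i ci in \<open>auto simp del: distrib_left\<close>)
    finally show ?thesis by (simp add: J1 e_eq[OF t])
  qed
  have within: "at t within {0..T} = at t" if "t \<in> {0<..<T}" for t
    using that by (intro at_within_interior) auto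

  \<comment> \<open>Both functionals are products in $L^2$; at interior times the equations can be inserted.\<close>
  have de: "(e has_real_derivative J (\<lambda>x. 1 * (r' t x * r t x)) + J (\<lambda>x. 1 * (r t x * r' t x)) +
      (J (\<lambda>x. 1 * (w' t x * w t x)) + J (\<lambda>x. 1 * (w t x * w' t x)))) (at t within {0..T})"
    if "t \<in> {0..T}" for t
    unfolding e_def J_def
    by (intro DERIV_add weighted_L2_product_has_derivative r w that) auto
  have dM: "(M has_real_derivative J (\<lambda>x. m x * (r' t x * w t x)) + J (\<lambda>x. m x * (r t x * w' t x))) (at t within {0..T})"
    if "t \<in> {0..T}" for t
    unfolding M_def J_def
    by (intro weighted_L2_product_has_derivative r w that mm mb) auto
  have ec: "continuous_on {0..T} e" and Mc: "continuous_on {0..T} M"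
    by (rule DERIV_continuous_on[OF de] DERIV_continuous_on[OF dM], assumption)+

  have de': "\<exists>e'. (e has_real_derivative e') (at t) \<and> e' \<le> K * e t + \<delta>\<^sup>2" if t: "t \<in> {0<..<T}" for t
  proof -
    have t': "t \<in> {0..T}" using t by auto
    note L = RW[OF t'] rxL[OF t'] wxL[OF t'] fL[OF t]
    note [measurable] = L[THEN meas]
    have r'_eq: "J (\<lambda>x. r t x * r' t x) = - J (\<lambda>x. r t x * wx t x)"
    proof -
      have "J (\<lambda>x. r t x * r' t x) = J (\<lambda>x. - (r t x * wx t x))"
        unfolding J_def by (rule integral_cong_AE[OF _ _ eventually_mono[OF eq[OF t]]])
          (auto simp: right_diff_distrib)
      then show ?thesis by (simp add: J_def)
    qed
    have w'_eq: "J (\<lambda>x. w t x * w' t x) = - J (\<lambda>x. w t x * rx t x) - J (\<lambda>x. w t x * f t x)"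
    proof -
      have "J (\<lambda>x. w t x * w' t x) = J (\<lambda>x. - (w t x * rx t x) - w t x * f t x)"
        unfolding J_def by (rule integral_cong_AE[OF _ _ eventually_mono[OF eq[OF t]]])
          (auto simp: right_diff_distrib)
      then show ?thesis using prod[OF L(3) L(5)] prod[OF L(3) L(7)] by (simp add: J_def)
    qed
    have "J (\<lambda>x. r t x * wx t x) + J (\<lambda>x. w t x * rx t x) = J (\<lambda>x. r t x * wx t x + w t x * rx t x)"
      unfolding J_def using prod[OF L(1) L(6)] prod[OF L(3) L(5)] by simp
    also have "\<dots> = integral {0..1} (\<lambda>x. r t x * wx t x + w t x * rx t x)"
      by (rule J_integral) (use prod[OF L(1) L(6)] prod[OF L(3) L(5)] in simp)
    also have "\<dots> = 0"
      using integration_by_parts_primitive[OF prim(1)[OF t'] prim(2)[OF t']] bc[OF t'] by simp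
    \<comment> \<open>The boundary term \<open>r * w\<close> vanishes with \<open>w\<close>; this is conservation of energy without source.\<close>
    finally have cancel: "J (\<lambda>x. r t x * wx t x) + J (\<lambda>x. w t x * rx t x) = 0" .
    have "- 2 * J (\<lambda>x. w t x * f t x) = J (\<lambda>x. - 2 * (w t x * f t x))"
      using prod[OF L(3) L(7)] by (simp add: J_def)
    also have "\<dots> \<le> K * e t + \<delta>\<^sup>2"
    proof (rule J_le[OF t'])
      show "integrable (lebesgue_on ?S) (\<lambda>x. - 2 * (w t x * f t x))" using prod[OF L(3) L(7)] by simp
      fix x assume x: "x \<in> ?S"
      have "- 2 * (w t x * f t x) \<le> 2 * (\<bar>w t x\<bar> * \<bar>f t x\<bar>)"
        using abs_ge_minus_self[of "w t x * f t x"] unfolding abs_mult by linarith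
      also have "\<dots> \<le> 2 * (\<bar>w t x\<bar> * (k * \<bar>w t x\<bar> + \<delta>))"
        using fb[OF t x] by (intro mult_left_mono) auto
      also have "\<dots> = 2 * k * (w t x)\<^sup>2 + 2 * \<bar>w t x\<bar> * \<delta>"
        by (simp add: algebra_simps power2_eq_square flip: abs_mult)
      also have "\<dots> \<le> 2 * k * (w t x)\<^sup>2 + ((w t x)\<^sup>2 + \<delta>\<^sup>2)"
        using sum_squares_bound[of "\<bar>w t x\<bar>" \<delta>] by simp
      also have "\<dots> = K * (w t x)\<^sup>2 + \<delta>\<^sup>2" by (simp add: K_def algebra_simps)
      also have "\<dots> \<le> K * ((r t x)\<^sup>2 + (w t x)\<^sup>2) + \<delta>\<^sup>2" using K by (simp add: mult_left_mono)
      finally show "- 2 * (w t x * f t x) \<le> K * ((r t x)\<^sup>2 + (w t x)\<^sup>2) + \<delta>\<^sup>2" .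
    qed
    finally have "- 2 * J (\<lambda>x. w t x * f t x) \<le> K * e t + \<delta>\<^sup>2" .
    moreover have "J (\<lambda>x. 1 * (r' t x * r t x)) + J (\<lambda>x. 1 * (r t x * r' t x)) +
      (J (\<lambda>x. 1 * (w' t x * w t x)) + J (\<lambda>x. 1 * (w t x * w' t x))) = - 2 * J (\<lambda>x. w t x * f t x)"
      using r'_eq w'_eq cancel by (simp add: mult.commute[of "r' t _"] mult.commute[of "w' t _"])
    ultimately show ?thesis using de[OF t'] unfolding within[OF t] by metis
  qed

  have e_bound: "e t \<le> T * exp (K * T) * \<delta>\<^sup>2" if t: "t \<in> {0..T}" for t
  proof -
    \<comment> \<open>Gronwall: \<open>exp (- K * t) * e t - \<delta>\<^sup>2 * t\<close> does not increase and starts at \<open>0\<close>.\<close>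
    have "exp (- K * t) * e t - \<delta>\<^sup>2 * t \<le> exp (- K * 0) * e 0 - \<delta>\<^sup>2 * 0"
    proof (rule DERIV_nonpos_imp_decreasing_open[where f = "\<lambda>t. exp (- K * t) * e t - \<delta>\<^sup>2 * t"])
      show "continuous_on {0..t} (\<lambda>t. exp (- K * t) * e t - \<delta>\<^sup>2 * t)"
        using t by (intro continuous_intros continuous_on_subset[OF ec]) auto
      fix s assume s: "0 < s" "s < t"
      then have sT: "s \<in> {0<..<T}" using t by auto
      from de'[OF sT] obtain e' where e': "(e has_real_derivative e') (at s)" "e' \<le> K * e s + \<delta>\<^sup>2" by blast
      have d: "((\<lambda>t. exp (- K * t) * e t - \<delta>\<^sup>2 * t) has_real_derivative exp (- K * s) * (e' - K * e s) - \<delta>\<^sup>2) (at s)"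
        by (auto intro!: derivative_eq_intros e'(1) simp: algebra_simps)
      have "exp (- K * s) * (e' - K * e s) \<le> exp (- K * s) * \<delta>\<^sup>2"
        using e'(2) by (intro mult_left_mono) auto
      also have "\<dots> \<le> 1 * \<delta>\<^sup>2" using K s by (intro mult_right_mono) auto
      finally show "\<exists>y. ((\<lambda>t. exp (- K * t) * e t - \<delta>\<^sup>2 * t) has_real_derivative y) (at s) \<and> y \<le> 0"
        using d by (intro exI[of _ "exp (- K * s) * (e' - K * e s) - \<delta>\<^sup>2"] conjI) simp_all
    qed (use t in auto)
    moreover have "e 0 = 0"
    proof -
      have "J (\<lambda>x. (r 0 x)\<^sup>2 + (w 0 x)\<^sup>2) = J (\<lambda>x. 0)"
        unfolding J_def by (rule Bochner_Integration.integral_cong) (use ic in \<open>auto simp: space_restrict_space\<close>)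
      then show ?thesis using e_eq[of 0] T by (simp add: J_def)
    qed
    ultimately have "exp (- K * t) * e t \<le> \<delta>\<^sup>2 * t" by simp
    then have "exp (K * t) * (exp (- K * t) * e t) \<le> exp (K * t) * (\<delta>\<^sup>2 * t)"
      by (intro mult_left_mono) auto
    also have "exp (K * t) * (exp (- K * t) * e t) = e t"
      by (simp add: mult.assoc[symmetric] exp_add[symmetric])
    also have "exp (K * t) * (\<delta>\<^sup>2 * t) \<le> exp (K * T) * (\<delta>\<^sup>2 * T)"
      using t K by (intro mult_mono) auto
    finally show ?thesis by (simp add: mult_ac)
  qed

  define b where "b t = (r t 0)\<^sup>2 + (r t 1)\<^sup>2" for t
  have bcont: "continuous_on {0..T} b" unfolding b_def by (intro continuous_intros trace)

  have dM': "\<exists>M'. (M has_real_derivative M') (at t) \<and> b t + 2 * M' \<le> (k + 3) * e t + \<delta>\<^sup>2" if t: "t \<in> {0<..<T}" for t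
  proof -
    have t': "t \<in> {0..T}" using t by auto
    note L = RW[OF t'] rxL[OF t'] wxL[OF t'] fL[OF t]
    note [measurable] = L[THEN meas] mm
    \<comment> \<open>Integration by parts of \<open>m * v\<^sup>2\<close>, used for \<open>v = r t\<close> and \<open>v = w t\<close>.\<close>
    have parts: "2 * J (\<lambda>x. m x * (v x * vx x)) + 2 * J (\<lambda>x. (v x)\<^sup>2) = (v 1)\<^sup>2 + (v 0)\<^sup>2"
      if p: "primitive_on 0 1 v vx" and vL: "v \<in> L2 ?S" "vx \<in> L2 ?S" for v vx
    proof -
      have pm: "primitive_on 0 1 m (\<lambda>x. 2)" by (auto simp: primitive_on_def m_def)
      have i: "integrable (lebesgue_on ?S) (\<lambda>x. m x * (v x * vx x))" "integrable (lebesgue_on ?S) (\<lambda>x. (v x)\<^sup>2)"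
        using mprod[OF vL] vL by (auto simp: L2_def)
      have "2 * J (\<lambda>x. m x * (v x * vx x)) + 2 * J (\<lambda>x. (v x)\<^sup>2) = J (\<lambda>x. 2 * (m x * (v x * vx x)) + 2 * (v x)\<^sup>2)"
        unfolding J_def using i by simp
      also have "\<dots> = integral {0..1} (\<lambda>x. 2 * (m x * (v x * vx x)) + 2 * (v x)\<^sup>2)"
        by (rule J_integral) (use i in simp)
      also have "(\<lambda>x. 2 * (m x * (v x * vx x)) + 2 * (v x)\<^sup>2) = (\<lambda>x. m x * (v x * vx x + v x * vx x) + (v x * v x) * 2)"
        by (simp add: fun_eq_iff power2_eq_square algebra_simps)
      also have "integral {0..1} \<dots> = m 1 * (v 1 * v 1) - m 0 * (v 0 * v 0)"
        by (rule integration_by_parts_primitive[OF pm primitive_on_mult[OF p p]]) simp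
      finally show ?thesis by (simp add: m_def power2_eq_square)
    qed
    have r'_eq: "J (\<lambda>x. m x * (r' t x * w t x)) = - J (\<lambda>x. m x * (w t x * wx t x))"
    proof -
      have "J (\<lambda>x. m x * (r' t x * w t x)) = J (\<lambda>x. - (m x * (w t x * wx t x)))"
        unfolding J_def by (rule integral_cong_AE[OF _ _ eventually_mono[OF eq[OF t]]])
          (auto simp: right_diff_distrib)
      then show ?thesis by (simp add: J_def)
    qed
    have w'_eq: "J (\<lambda>x. m x * (r t x * w' t x)) = - J (\<lambda>x. m x * (r t x * rx t x)) - J (\<lambda>x. m x * (r t x * f t x))"
    proof -
      have "J (\<lambda>x. m x * (r t x * w' t x)) = J (\<lambda>x. - (m x * (r t x * rx t x)) - m x * (r t x * f t x))"
        unfolding J_def by (rule integral_cong_AE[OF _ _ eventually_mono[OF eq[OF t]]])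
          (auto simp: right_diff_distrib)
      then show ?thesis using mprod[OF L(1) L(5)] mprod[OF L(1) L(7)] by (simp add: J_def)
    qed
    have "- 2 * J (\<lambda>x. m x * (r t x * f t x)) = J (\<lambda>x. - 2 * (m x * (r t x * f t x)))"
      using mprod[OF L(1) L(7)] by (simp add: J_def)
    also have "\<dots> \<le> (k + 1) * e t + \<delta>\<^sup>2"
    proof (rule J_le[OF t'])
      show "integrable (lebesgue_on ?S) (\<lambda>x. - 2 * (m x * (r t x * f t x)))" using mprod[OF L(1) L(7)] by simp
      fix x assume x: "x \<in> ?S"
      have "- 2 * (m x * (r t x * f t x)) \<le> 2 * (\<bar>m x\<bar> * (\<bar>r t x\<bar> * \<bar>f t x\<bar>))"
        using abs_ge_minus_self[of "m x * (r t x * f t x)"] unfolding abs_mult by linarith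
      also have "\<dots> \<le> 2 * (1 * (\<bar>r t x\<bar> * (k * \<bar>w t x\<bar> + \<delta>)))"
        using fb[OF t x] mb[OF x] by (intro mult_left_mono mult_mono) auto
      also have "\<dots> = k * (2 * \<bar>r t x\<bar> * \<bar>w t x\<bar>) + 2 * \<bar>r t x\<bar> * \<delta>"
        by (simp add: algebra_simps)
      also have "\<dots> \<le> k * ((r t x)\<^sup>2 + (w t x)\<^sup>2) + ((r t x)\<^sup>2 + \<delta>\<^sup>2)"
        using sum_squares_bound[of "\<bar>r t x\<bar>" \<delta>] sum_squares_bound[of "\<bar>r t x\<bar>" "\<bar>w t x\<bar>"] k
        by (intro add_mono mult_left_mono) auto
      also have "\<dots> \<le> (k + 1) * ((r t x)\<^sup>2 + (w t x)\<^sup>2) + \<delta>\<^sup>2" by (simp add: algebra_simps)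
      finally show "- 2 * (m x * (r t x * f t x)) \<le> (k + 1) * ((r t x)\<^sup>2 + (w t x)\<^sup>2) + \<delta>\<^sup>2" .
    qed
    finally have "- 2 * J (\<lambda>x. m x * (r t x * f t x)) \<le> (k + 1) * e t + \<delta>\<^sup>2" .
    moreover have "e t = J (\<lambda>x. (r t x)\<^sup>2) + J (\<lambda>x. (w t x)\<^sup>2)" by (simp add: e_def power2_eq_square)
    ultimately have "b t + 2 * (J (\<lambda>x. m x * (r' t x * w t x)) + J (\<lambda>x. m x * (r t x * w' t x))) \<le> (k + 3) * e t + \<delta>\<^sup>2"
      using parts[OF prim(1)[OF t'] L(1,5)] parts[OF prim(2)[OF t'] L(3,6)] bc[OF t'] r'_eq w'_eq
      by (simp add: b_def algebra_simps)
    then show ?thesis using dM[OF t'] unfolding within[OF t] by blast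
  qed

  define B where "B = ((k + 3) * (T * exp (K * T)) + 1) * \<delta>\<^sup>2"
  \<comment> \<open>The integral over time is taken by monotonicity, which avoids asking whether the derivative of \<open>M\<close>
    is integrable.\<close>
  have "integral {0..T} b + 2 * M T - B * T \<le> integral {0..0} b + 2 * M 0 - B * 0"
  proof (rule DERIV_nonpos_imp_decreasing_open[where f = "\<lambda>t. integral {0..t} b + 2 * M t - B * t"])
    show "continuous_on {0..T} (\<lambda>t. integral {0..t} b + 2 * M t - B * t)"
      by (intro continuous_intros Mc indefinite_integral_continuous_1 integrable_continuous_real bcont)
    fix t assume "0 < t" "t < T"
    then have t: "t \<in> {0<..<T}" "t \<in> {0..T}" by auto
    from dM'[OF t(1)] obtain M' where M': "(M has_real_derivative M') (at t)"
      "b t + 2 * M' \<le> (k + 3) * e t + \<delta>\<^sup>2" by blast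
    have di: "((\<lambda>t. integral {0..t} b) has_real_derivative b t) (at t)"
      using integral_has_real_derivative[OF bcont t(2)] unfolding within[OF t(1)] .
    have "((\<lambda>t. integral {0..t} b + 2 * M t - B * t) has_real_derivative b t + 2 * M' - B) (at t)"
      by (auto intro!: derivative_eq_intros di M'(1))
    moreover have "(k + 3) * e t \<le> (k + 3) * (T * exp (K * T) * \<delta>\<^sup>2)"
      using e_bound[OF t(2)] k by (intro mult_left_mono) auto
    then have "b t + 2 * M' - B \<le> 0" using M'(2) by (simp add: B_def algebra_simps)
    ultimately show "\<exists>y. ((\<lambda>t. integral {0..t} b + 2 * M t - B * t) has_real_derivative y) (at t) \<and> y \<le> 0"
      by blast
  qed (use T in auto)
  moreover have "M 0 = 0"
  proof -
    have "M 0 = J (\<lambda>x. 0)" unfolding M_def J_def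
      by (rule Bochner_Integration.integral_cong) (use ic in \<open>auto simp: space_restrict_space\<close>)
    then show ?thesis by (simp add: J_def)
  qed
  moreover have "- 2 * M T \<le> e T"
  proof -
    have TT: "T \<in> {0..T}" using T by simp
    note L = RW[OF TT]
    have "- 2 * M T = J (\<lambda>x. - 2 * (m x * (r T x * w T x)))"
      unfolding M_def J_def using mprod[OF L(1) L(3)] by simp
    also have "\<dots> \<le> J (\<lambda>x. (r T x)\<^sup>2 + (w T x)\<^sup>2)"
      unfolding J_def
    proof (rule integral_mono)
      show "integrable (lebesgue_on ?S) (\<lambda>x. - 2 * (m x * (r T x * w T x)))" using mprod[OF L(1) L(3)] by simp
      show "integrable (lebesgue_on ?S) (\<lambda>x. (r T x)\<^sup>2 + (w T x)\<^sup>2)" using L by (simp add: L2_def)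
      fix x assume "x \<in> space (lebesgue_on ?S)"
      then have x: "x \<in> ?S" by (simp add: space_restrict_space)
      have "- 2 * (m x * (r T x * w T x)) \<le> 2 * (\<bar>m x\<bar> * (\<bar>r T x\<bar> * \<bar>w T x\<bar>))"
        using abs_ge_minus_self[of "m x * (r T x * w T x)"] unfolding abs_mult by linarith
      also have "\<dots> \<le> 2 * (1 * (\<bar>r T x\<bar> * \<bar>w T x\<bar>))"
        using mb[OF x] by (intro mult_left_mono mult_mono) auto
      also have "\<dots> \<le> (r T x)\<^sup>2 + (w T x)\<^sup>2"
        using sum_squares_bound[of "\<bar>r T x\<bar>" "\<bar>w T x\<bar>"] by simp
      finally show "- 2 * (m x * (r T x * w T x)) \<le> (r T x)\<^sup>2 + (w T x)\<^sup>2" .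
    qed
    finally show ?thesis using e_eq[OF TT] by simp
  qed
  moreover have "e T \<le> T * exp (K * T) * \<delta>\<^sup>2" using e_bound[of T] T by simp
  ultimately have "integral {0..T} b \<le> B * T + T * exp (K * T) * \<delta>\<^sup>2" by simp
  then show ?thesis by (simp add: b_def[abs_def] B_def K_def algebra_simps)
qed

section \<open>Stability of the pressure drop\<close>

text \<open>The parameter is the indefinite integral of its weak derivative, which takes values in \<open>[a0, a1]\<close>
  almost everywhere.\<close>
lemma admissible_Lipschitz:
  assumes b: "admissible a0 a1 a2 a3 b" and "a0 > 0"
  shows "\<bar>b x - b y\<bar> \<le> a1 * \<bar>x - y\<bar>"
proof -
  define d where "d = weak_deriv 1 UNIV b"
  have wd: "has_weak_deriv 1 UNIV b d"
    using b weak_deriv_has_weak_deriv unfolding admissible_def Wk_inf_loc_def d_def by fastforce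
  have bc: "continuous_on UNIV b" and ae: "AE s in lebesgue. a0 \<le> d s \<and> d s \<le> a1"
    using b by (auto simp: admissible_def d_def)
  have step: "0 \<le> b z - b x \<and> b z - b x \<le> a1 * (z - x)" if "x \<le> z" for x z
  proof -
    have "{x..z} \<subseteq> UNIV" by simp
    note W = weak_deriv_integral[OF open_UNIV wd bc this that]
    have ae': "AE s in lebesgue_on {x..z}. a0 \<le> d s \<and> d s \<le> a1"
      using ae by (auto simp: AE_restrict_space_iff elim: eventually_mono)
    have "(LINT t|lebesgue_on {x..z}. d t) \<le> (LINT t|lebesgue_on {x..z}. a1)"
      by (rule integral_mono_AE[OF W(1)]) (use ae' in \<open>auto elim: eventually_mono\<close>)
    moreover have "0 \<le> (LINT t|lebesgue_on {x..z}. d t)"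
      by (rule integral_nonneg_AE) (use ae' \<open>a0 > 0\<close> in \<open>auto elim!: eventually_mono\<close>)
    ultimately show ?thesis using W(2) that by (simp add: measure_restrict_space mult.commute)
  qed
  show ?thesis using step[of x y] step[of y x] by (cases "x \<le> y") (auto simp: abs_if)
qed

lemma classical_solution_H1:
  assumes s: "classical_solution T c g0 g1 a p u" and t: "t \<in> {0..T}"
  shows "primitive_on 0 1 (p t) (weak_deriv 1 {0<..<1} (p t))" "weak_deriv 1 {0<..<1} (p t) \<in> L2 {0<..<1}"
    "primitive_on 0 1 (u t) (weak_deriv 1 {0<..<1} (u t))" "weak_deriv 1 {0<..<1} (u t) \<in> L2 {0<..<1}"
proof -
  have c: "continuous_on {0..1} (p t)" "continuous_on {0..1} (u t)"
    and H: "p t \<in> Hk 1 {0<..<1}" "u t \<in> Hk 1 {0<..<1}"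
    using s t by (auto simp: classical_solution_def C0_valued_def)
  note P = Hk_weak_deriv[OF H(1)] and U = Hk_weak_deriv[OF H(2)]
  show "primitive_on 0 1 (p t) (weak_deriv 1 {0<..<1} (p t))" "weak_deriv 1 {0<..<1} (p t) \<in> L2 {0<..<1}"
    "primitive_on 0 1 (u t) (weak_deriv 1 {0<..<1} (u t))" "weak_deriv 1 {0<..<1} (u t) \<in> L2 {0<..<1}"
    using weak_deriv_imp_primitive_on[OF c(1) P(1,2)] weak_deriv_imp_primitive_on[OF c(2) U(1,2)] P U by auto
qed

text \<open>The splitting \<open>a (u t x) - b (v t x) = (a (u t x) - a (v t x)) + (a - b) (v t x)\<close> bounds the source of the
  difference system as \<open>energy_and_multiplier_estimate\<close> requires.\<close>
lemma pressure_trace_stability: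
  assumes T: "T > 0" and a1: "a1 \<ge> 0"
    and sol: "classical_solution T c g0 g1 a p u" "classical_solution T c g0 g1 b q v"
    and ac: "continuous_on UNIV a" "continuous_on UNIV b"
    and Lip: "\<And>x y. \<bar>a x - a y\<bar> \<le> a1 * \<bar>x - y\<bar>"
    and \<delta>: "\<And>t x. t \<in> {0..T} \<Longrightarrow> x \<in> {0..1} \<Longrightarrow> \<bar>a (v t x) - b (v t x)\<bar> \<le> \<delta>"
  shows "integral {0..T} (\<lambda>t. (p t 0 - q t 0)\<^sup>2 + (p t 1 - q t 1)\<^sup>2) \<le>
    (T * ((a1 + 3) * T * exp ((2 * a1 + 1) * T) + 1) + T * exp ((2 * a1 + 1) * T)) * \<delta>\<^sup>2"
proof -
  let ?S = "{0<..<1::real}"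
  from sol(1) obtain p' u' where 1: "C1_valued (L2 ?S) (L2_norm ?S) {0..T} p p'" "C1_valued (L2 ?S) (L2_norm ?S) {0..T} u u'"
    "\<And>t. t \<in> {0<..<T} \<Longrightarrow> AE x in lebesgue_on ?S.
       p' t x + weak_deriv 1 ?S (u t) x = 0 \<and> u' t x + weak_deriv 1 ?S (p t) x + a (u t x) = 0"
    unfolding classical_solution_def by blast
  from sol(2) obtain q' v' where 2: "C1_valued (L2 ?S) (L2_norm ?S) {0..T} q q'" "C1_valued (L2 ?S) (L2_norm ?S) {0..T} v v'"
    "\<And>t. t \<in> {0<..<T} \<Longrightarrow> AE x in lebesgue_on ?S.
       q' t x + weak_deriv 1 ?S (v t) x = 0 \<and> v' t x + weak_deriv 1 ?S (q t) x + b (v t x) = 0"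
    unfolding classical_solution_def by blast
  have cont: "continuous_on {0..1} (p t)" "continuous_on {0..1} (u t)" "continuous_on {0..1} (q t)" "continuous_on {0..1} (v t)"
    if "t \<in> {0..T}" for t
    using sol that by (auto simp: classical_solution_def)
  have H: "C0_valued (Hk 1 ?S) (Hk_norm 1 ?S) {0..T} p" "C0_valued (Hk 1 ?S) (Hk_norm 1 ?S) {0..T} q"
    using sol by (auto simp: classical_solution_def)
  note h1 = classical_solution_H1[OF sol(1)] and h2 = classical_solution_H1[OF sol(2)]
  show ?thesis
  proof (rule energy_and_multiplier_estimate[OF T a1 C1_valued_diff[OF 1(1) 2(1)] C1_valued_diff[OF 1(2) 2(2)]
        primitive_on_diff[OF h1(1) h2(1)] primitive_on_diff[OF h1(3) h2(3)] L2_diff[OF h1(2) h2(2)]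
        L2_diff[OF h1(4) h2(4)], where f = "\<lambda>t x. a (u t x) - b (v t x)"])
    fix t assume t: "t \<in> {0<..<T}"
    then have t': "t \<in> {0..T}" by auto
    show "AE x in lebesgue_on ?S.
        p' t x - q' t x = - (weak_deriv 1 ?S (u t) x - weak_deriv 1 ?S (v t) x) \<and>
        u' t x - v' t x = - (weak_deriv 1 ?S (p t) x - weak_deriv 1 ?S (q t) x) - (a (u t x) - b (v t x))"
      using 1(3)[OF t] 2(3)[OF t] by eventually_elim auto
    show "(\<lambda>x. a (u t x) - b (v t x)) \<in> L2 ?S"
      by (intro continuous_imp_L2 continuous_on_diff continuous_on_compose2[OF ac(1) cont(2)[OF t']]
          continuous_on_compose2[OF ac(2) cont(4)[OF t']]) auto
    fix x :: real assume "x \<in> ?S"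
    then have x: "x \<in> {0..1}" by auto
    show "\<bar>a (u t x) - b (v t x)\<bar> \<le> a1 * \<bar>u t x - v t x\<bar> + \<delta>"
      using Lip[of "u t x" "v t x"] \<delta>[OF t' x] by linarith
  next
    show "u t 0 - v t 0 = 0 \<and> u t 1 - v t 1 = 0" if "t \<in> {0..T}" for t
      using sol that by (simp add: classical_solution_def)
    show "p 0 x - q 0 x = 0 \<and> u 0 x - v 0 x = 0" if "x \<in> {0..1}" for x
      using sol that by (simp add: classical_solution_def)
    show "continuous_on {0..T} (\<lambda>t. p t 0 - q t 0)"
      by (intro continuous_on_diff C0_valued_H1_trace_continuous[OF H(1)] C0_valued_H1_trace_continuous[OF H(2)] cont) auto
    show "continuous_on {0..T} (\<lambda>t. p t 1 - q t 1)"
      by (intro continuous_on_diff C0_valued_H1_trace_continuous[OF H(1)] C0_valued_H1_trace_continuous[OF H(2)] cont) auto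
  qed
qed

lemma pressure_traces_continuous:
  assumes sol: "classical_solution T c g0 g1 a p u"
  shows "continuous_on {0..T} (\<lambda>t. p t 0)" "continuous_on {0..T} (\<lambda>t. p t 1)"
proof -
  have H: "C0_valued (Hk 1 {0<..<1}) (Hk_norm 1 {0<..<1}) {0..T} p"
    and c: "\<And>t. t \<in> {0..T} \<Longrightarrow> continuous_on {0..1} (p t)"
    using sol by (auto simp: classical_solution_def)
  show "continuous_on {0..T} (\<lambda>t. p t 0)" "continuous_on {0..T} (\<lambda>t. p t 1)"
    by (rule C0_valued_H1_trace_continuous[OF H _ c]; simp)+
qed

theorem theorem4p1:
  fixes T c a0 a1 a2 a3 ul uh :: real and g0 g1 :: "real \<Rightarrow> real"
  assumes "T > 0" and "a0 > 0" and "a1 > 0" and "a2 > 0" and "a3 > 0"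
    and "Ck_on 4 {0..T} g0" and "Ck_on 4 {0..T} g1"
    and "g0 0 = 0" and "g1 0 = 0"
    and "(g0 has_real_derivative 0) (at 0 within {0..T})"
    and "(g1 has_real_derivative 0) (at 0 within {0..T})"
    and "ul < uh"
    and bounds: "\<And>a p u x t. admissible a0 a1 a2 a3 a \<Longrightarrow> classical_solution T c g0 g1 a p u \<Longrightarrow>
           x \<in> {0..1} \<Longrightarrow> t \<in> {0..T} \<Longrightarrow> ul \<le> u t x \<and> u t x \<le> uh"
  shows "\<exists>C\<^sub>L\<ge>0. \<forall>a\<in>DF a0 a1 a2 a3 ul uh. \<forall>b\<in>DF a0 a1 a2 a3 ul uh. \<forall>y z.
           forward_graph a0 a1 a2 a3 ul uh T c g0 g1 a y \<longrightarrow>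
           forward_graph a0 a1 a2 a3 ul uh T c g0 g1 b z \<longrightarrow>
           y \<in> L2 {0<..<T} \<and> z \<in> L2 {0<..<T} \<and>
           L2_norm {0<..<T} (\<lambda>t. y t - z t) \<le> C\<^sub>L * Hk_norm 2 {ul<..<uh} (\<lambda>s. a s - b s)"
proof -
  \<comment> \<open>\<open>A\<close> is the constant of the trace estimate, \<open>B\<close> a bound for the norm of the embedding of $H^1$ into the
    continuous functions; the factor \<open>2\<close> comes from $(x - y)^2 \<le> 2 (x^2 + y^2)$.\<close>
  define A where "A = T * ((a1 + 3) * T * exp ((2 * a1 + 1) * T) + 1) + T * exp ((2 * a1 + 1) * T)"
  define B where "B = 1 / sqrt (uh - ul) + sqrt (uh - ul)"
  have A: "A \<ge> 0" using \<open>T > 0\<close> \<open>a1 > 0\<close> by (simp add: A_def)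
  have B: "B \<ge> 0" using \<open>ul < uh\<close> by (simp add: B_def)
  have main: "y \<in> L2 {0<..<T} \<and> z \<in> L2 {0<..<T} \<and>
      L2_norm {0<..<T} (\<lambda>t. y t - z t) \<le> (sqrt (2 * A) * B) * Hk_norm 2 {ul<..<uh} (\<lambda>s. a s - b s)"
    if a: "a \<in> DF a0 a1 a2 a3 ul uh" and b: "b \<in> DF a0 a1 a2 a3 ul uh"
      and y: "forward_graph a0 a1 a2 a3 ul uh T c g0 g1 a y"
      and z: "forward_graph a0 a1 a2 a3 ul uh T c g0 g1 b z" for a b y z
  proof -
    from y obtain \<alpha> p u where \<alpha>: "admissible a0 a1 a2 a3 \<alpha>" "\<And>s. s \<in> {ul..uh} \<Longrightarrow> a s = \<alpha> s"
      and sp: "classical_solution T c g0 g1 \<alpha> p u" and y_eq: "y = (\<lambda>t. p t 0 - p t 1)"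
      unfolding forward_graph_def by blast
    from z obtain \<beta> q v where \<beta>: "admissible a0 a1 a2 a3 \<beta>" "\<And>s. s \<in> {ul..uh} \<Longrightarrow> b s = \<beta> s"
      and sq: "classical_solution T c g0 g1 \<beta> q v" and z_eq: "z = (\<lambda>t. q t 0 - q t 1)"
      unfolding forward_graph_def by blast
    have cc: "continuous_on UNIV \<alpha>" "continuous_on UNIV \<beta>" using \<alpha> \<beta> by (auto simp: admissible_def)
    define N where "N = Hk_norm 2 {ul<..<uh} (\<lambda>s. a s - b s)"
    have N: "N \<ge> 0" using L2_norms_le_Hk_norm(1)[of 2 "{ul<..<uh}" "\<lambda>s. a s - b s"]
        L2_norm_nonneg[of "{ul<..<uh}" "\<lambda>s. a s - b s"] by (simp add: N_def)
    have cab: "continuous_on {ul..uh} (\<lambda>s. a s - b s)"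
      by (rule continuous_on_eq[of _ "\<lambda>s. \<alpha> s - \<beta> s"])
         (use \<alpha> \<beta> in \<open>auto intro!: continuous_on_diff continuous_on_subset[OF cc(1)] continuous_on_subset[OF cc(2)]\<close>)
    have sup: "\<bar>a s - b s\<bar> \<le> B * N" if "s \<in> {ul..uh}" for s
      unfolding B_def N_def by (rule Hk_diff_sup_le[OF _ _ _ \<open>ul < uh\<close> cab that]) (use a b in \<open>auto simp: DF_def\<close>)
    have est: "integral {0..T} (\<lambda>t. (p t 0 - q t 0)\<^sup>2 + (p t 1 - q t 1)\<^sup>2) \<le> A * (B * N)\<^sup>2"
      unfolding A_def
    proof (rule pressure_trace_stability[OF \<open>T > 0\<close> _ sp sq cc admissible_Lipschitz[OF \<alpha>(1) \<open>a0 > 0\<close>]])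
      fix t x :: real assume "t \<in> {0..T}" "x \<in> {0..1}"
      then have v: "v t x \<in> {ul..uh}" using bounds[OF \<beta>(1) sq] by auto
      then show "\<bar>\<alpha> (v t x) - \<beta> (v t x)\<bar> \<le> B * N" using sup[OF v] \<alpha>(2)[OF v] \<beta>(2)[OF v] by simp
    qed (use \<open>a1 > 0\<close> in simp)
    note pc = pressure_traces_continuous[OF sp] and qc = pressure_traces_continuous[OF sq]
    have yc: "continuous_on {0..T} y" and zc: "continuous_on {0..T} z"
      unfolding y_eq z_eq by (intro continuous_intros pc qc)+
    have dL: "(\<lambda>t. y t - z t) \<in> L2 {0<..<T}" by (intro continuous_imp_L2 continuous_on_diff yc zc)
    have "(L2_norm {0<..<T} (\<lambda>t. y t - z t))\<^sup>2 = integral {0..T} (\<lambda>t. (y t - z t)\<^sup>2)"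
      unfolding L2_norm_square
      by (rule integrable_lebesgue_on_open_interval(2)) (use dL in \<open>simp add: L2_def\<close>)
    also have "\<dots> \<le> integral {0..T} (\<lambda>t. 2 * ((p t 0 - q t 0)\<^sup>2 + (p t 1 - q t 1)\<^sup>2))"
    proof (rule integral_le)
      show "(\<lambda>t. (y t - z t)\<^sup>2) integrable_on {0..T}"
        by (intro integrable_continuous_real continuous_intros yc zc)
      show "(\<lambda>t. 2 * ((p t 0 - q t 0)\<^sup>2 + (p t 1 - q t 1)\<^sup>2)) integrable_on {0..T}"
        by (intro integrable_continuous_real continuous_intros pc qc)
      fix t
      have "(x - y)\<^sup>2 \<le> 2 * (x\<^sup>2 + y\<^sup>2)" for x y :: real
        using zero_le_power2[of "x + y"] by (simp add: power2_eq_square algebra_simps)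
      from this[of "p t 0 - q t 0" "p t 1 - q t 1"]
      show "(y t - z t)\<^sup>2 \<le> 2 * ((p t 0 - q t 0)\<^sup>2 + (p t 1 - q t 1)\<^sup>2)"
        by (simp add: y_eq z_eq algebra_simps)
    qed
    also have "\<dots> = 2 * integral {0..T} (\<lambda>t. (p t 0 - q t 0)\<^sup>2 + (p t 1 - q t 1)\<^sup>2)"
      by (rule Henstock_Kurzweil_Integration.integral_mult_right)
    also have "\<dots> \<le> 2 * (A * (B * N)\<^sup>2)" using est by simp
    finally have "L2_norm {0<..<T} (\<lambda>t. y t - z t) \<le> sqrt (2 * (A * (B * N)\<^sup>2))"
      by (rule real_le_rsqrt)
    also have "\<dots> = sqrt (2 * A) * B * N"
      using A B N by (simp add: real_sqrt_mult)
    finally show ?thesis using continuous_imp_L2[OF yc] continuous_imp_L2[OF zc] by (simp add: N_def)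
  qed
  show ?thesis
    by (rule exI[of _ "sqrt (2 * A) * B"]) (use A B main in \<open>auto\<close>)
qed

end
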